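(* Let $\beta=-2K\zeta(\alpha)+\alpha\zeta(\alpha+2K)-\alpha\zeta(\alpha)$, suppose that $\Re\beta>0$ and let $t\in\mathbf C$ be such that $\Psi(x+2t;\alpha)$ is analytic for $x\in[0,2K]$. Let $\phi_{(t)}(x)=\Psi(x+2t;\alpha)$ and $h(s)=\int_0^{2K}e^{-su}\phi_{(t)}(u)\,du$. Then $\phi_{(t)}$ is a theta function and has an exponential expansion $$\phi_{(t)}(x)=\sum_{m=-\infty}^\infty\frac1{2K}\,h\Bigl(\frac{2\pi im-\beta}{2K}\Bigr)e^{x(2\pi im-\beta)/(2K)}\qquad(x>0),$$ and $\hat\phi_{(t)}$ is a meromorphic function with poles in an arithmetic progression.
   Context: Let $0<k<1$, $K=K(k)=\int_0^{\pi/2}\frac{du}{\sqrt{1-k^2\sin^2u}}$ and $K'=K(\sqrt{1-k^2})$. Let $\mathbf L=\{2Km+2iK'n:m,n\in\mathbf Z\}$, let $$\sigma(z)=z\prod_{\omega\in\mathbf L\setminus\{0\}}\Bigl(1-\frac z\omega\Bigr)\exp\Bigl(\frac z\omega+\frac12\Bigl(\frac z\omega\Bigr)^2\Bigr)$$ be Weierstrass's sigma function, $\zeta=\sigma'/\sigma$, and for a spectral parameter $\alpha\in\mathbf C\setminus\mathbf L$ let $$\Psi(x;\alpha)=-\frac{\sigma(x-\alpha)}{\sigma(\alpha)\sigma(x)}e^{\zeta(\alpha)x},$$ a solution of Lamé's equation (with $\ell=1$) $-\Psi''+2\wp(x)\Psi+\wp(\alpha)\Psi=0$, $\wp=-\zeta'$.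 A theta function (elliptic function of the second kind) with respect to $\mathbf L$ is a meromorphic function $\theta$ on $\mathbf C$, not identically zero, such that $\theta(x+u)=\theta(x)e^{2\pi i(L(x,u)+\eta(u))}$ for all $x\in\mathbf C$, $u\in\mathbf L$, for some $L(x,u)$ linear in $x$ and some $\eta:\mathbf L\to\mathbf C$. The transfer function is the Laplace transform $\hat\phi(s)=\int_0^\infty e^{-su}\phi(u)\,du$ (continued meromorphically). *)

theory Defs
  imports "HOL-Complex_Analysis.Complex_Analysis"
begin

definition ellK :: "real \<Rightarrow> real" where
  "ellK k = integral {0..pi/2} (\<lambda>u. 1 / sqrt (1 - k^2 * (sin u)^2))"

definition ellK' :: "real \<Rightarrow> real" where
  "ellK' k = ellK (sqrt (1 - k^2))"

definition lattice :: "real \<Rightarrow> complex set" where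
  "lattice k = {of_real (2 * ellK k) * of_int m + of_real (2 * ellK' k) * \<i> * of_int n | m n :: int. True}"

text \<open>
  The product is unordered: the limit of the finite partial products along the directed set of
  finite subsets of the punctured lattice, as for \<^const>\<open>infsum\<close>.
\<close>

definition wsigma :: "real \<Rightarrow> complex \<Rightarrow> complex" where
  "wsigma k z = z * Lim (finite_subsets_at_top (lattice k - {0}))
      (\<lambda>W. \<Prod>\<omega>\<in>W. (1 - z / \<omega>) * exp (z / \<omega> + 1 / 2 * (z / \<omega>)^2))"

definition wzeta :: "real \<Rightarrow> complex \<Rightarrow> complex" where
  "wzeta k z = deriv (wsigma k) z / wsigma k z"

text \<open>
  At lattice points, where this function has poles, division by zero gives it the value 0;
  this is the convention of \<^const>\<open>nicely_meromorphic_on\<close>.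
\<close>

definition lame_Psi :: "real \<Rightarrow> complex \<Rightarrow> complex \<Rightarrow> complex" where
  "lame_Psi k \<alpha> x =
     - (wsigma k (x - \<alpha>) / (wsigma k \<alpha> * wsigma k x)) * exp (wzeta k \<alpha> * x)"

definition lame_phi :: "real \<Rightarrow> complex \<Rightarrow> complex \<Rightarrow> complex \<Rightarrow> complex" where
  "lame_phi k \<alpha> t x = lame_Psi k \<alpha> (x + 2 * t)"

definition lame_beta :: "real \<Rightarrow> complex \<Rightarrow> complex" where
  "lame_beta k \<alpha> = - 2 * of_real (ellK k) * wzeta k \<alpha>
     + \<alpha> * wzeta k (\<alpha> + 2 * of_real (ellK k)) - \<alpha> * wzeta k \<alpha>"

definition lame_h :: "real \<Rightarrow> complex \<Rightarrow> complex \<Rightarrow> complex \<Rightarrow> complex" where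
  "lame_h k \<alpha> t s =
     integral {0..2 * ellK k} (\<lambda>u::real. exp (- s * of_real u) * lame_phi k \<alpha> t (of_real u))"

text \<open>
  Meromorphic functions are required to be normalised (\<^const>\<open>nicely_meromorphic_on\<close>: value 0 at
  poles, no removable singularities), so that being not identically zero and satisfying the
  functional equation at every point do not depend on arbitrary values on a discrete set.
  Linearity in \<open>x\<close> is over the complex numbers, hence the scalar multiplication \<open>(*)\<close>.
\<close>

definition theta_function :: "complex set \<Rightarrow> (complex \<Rightarrow> complex) \<Rightarrow> bool" where
  "theta_function \<Lambda> \<theta> \<longleftrightarrow>
     \<theta> nicely_meromorphic_on UNIV \<and> (\<exists>x. \<theta> x \<noteq> 0) \<and>
     (\<exists>(L :: complex \<Rightarrow> complex \<Rightarrow> complex) (\<eta> :: complex \<Rightarrow> complex).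
        (\<forall>u\<in>\<Lambda>. Vector_Spaces.linear (*) (*) (\<lambda>x. L x u)) \<and>
        (\<forall>x. \<forall>u\<in>\<Lambda>. \<theta> (x + u) = \<theta> x * exp (2 * of_real pi * \<i> * (L x u + \<eta> u))))"

text \<open>
  \<open>F\<close> is the meromorphic continuation to the plane of the Laplace transform of \<open>\<phi>\<close>,
  whose defining integral is required to converge absolutely for \<open>Re s > 0\<close>.
\<close>

definition transfer_function :: "(complex \<Rightarrow> complex) \<Rightarrow> (complex \<Rightarrow> complex) \<Rightarrow> bool" where
  "transfer_function \<phi> F \<longleftrightarrow>
     F nicely_meromorphic_on UNIV \<and>
     (\<forall>s. Re s > 0 \<longrightarrow>
        (\<lambda>u::real. exp (- s * of_real u) * \<phi> (of_real u)) absolutely_integrable_on {0..} \<and>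
        F s = integral {0..} (\<lambda>u::real. exp (- s * of_real u) * \<phi> (of_real u)))"

end

theory Submission
  imports Defs
begin

text \<open>
  Everything follows from one functional equation: for every lattice point \<open>u\<close> there is a number \<open>M u\<close>
  such that \<open>\<Psi> (x + u) = \<Psi> x * exp (M u)\<close> for all \<open>x\<close>. Because \<open>M u\<close> does not depend on \<open>x\<close>, this is the
  defining equation of a theta function with \<open>L = 0\<close>. For the real period \<open>u = T = 2 * K\<close> one has
  \<open>M T = - \<beta>\<close>. So \<open>\<phi> (x + T) = exp (- \<beta>) * \<phi> x\<close>, and the other two claims are consequences of this
  relation together with analyticity on the real line: \<open>exp (\<beta> * x / T) * \<phi> x\<close> is \<open>T\<close>-periodic and
  analytic, hence the sum of its Fourier series (\<open>fourier_series_analytic\<close>), whose coefficients are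
  values of \<open>h\<close> divided by \<open>T\<close>; and the Laplace integral \<open>I\<close> satisfies \<open>I = h s + exp (- (\<beta> + s * T)) * I\<close>, so it is an
  entire function divided by \<open>1 - exp (- (\<beta> + s * T))\<close> (\<open>transfer_function_quasi_periodic\<close>).

  The functional equation rests on the quasi-periodicity of the sigma function
  (\<open>sigma_quasi_periodic\<close>). It is obtained from the unordered product itself, without the elliptic
  function \<open>\<wp>\<close>. A finite partial product over a set that is symmetric under \<open>z \<mapsto> \<omega> - z\<close> is reproduced by
  this reflection up to a factor \<open>c * exp (a * z)\<close> (\<open>partial_sigma_reflect\<close>). A multiplicative relation
  between four arguments eliminates \<open>a\<close> and \<open>c\<close> and passes to the limit (\<open>sigma_reflect\<close>). Taking its
  logarithmic derivative shows that \<open>\<zeta> (z + \<omega>) - \<zeta> z\<close> is constant (\<open>zeta_shift_diff\<close>), which is the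
  infinitesimal form of quasi-periodicity.

  Convergence of the product to an entire function with the right zeros is proved for every set with
  a summable power of the inverse moduli (\<open>canonical_product_local\<close>); for the lattice at hand it
  reduces to a product of two convergent sums over the integers (\<open>rectangular_lattice\<close>).
\<close>

section \<open>Unordered canonical products\<close>

lemma finite_summable_inverse_power:
  fixes A :: "complex set"
  assumes "0 \<notin> A" and "(\<lambda>\<omega>. norm (inverse \<omega>) ^ n) summable_on A"
  shows "finite (A \<inter> ball 0 r)"
proof (rule ccontr)
  assume inf: "infinite (A \<inter> ball 0 r)"
  then have "r > 0"
    by (cases "r > 0") (auto simp: ball_empty)
  have "(\<lambda>\<omega>. norm (inverse \<omega>) ^ n) summable_on (A \<inter> ball 0 r)"
    by (rule summable_on_subset_banach[OF assms(2)]) auto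
  then have "(\<lambda>\<omega>. inverse r ^ n) summable_on (A \<inter> ball 0 r)"
    by (rule summable_on_comparison_test)
       (use \<open>r > 0\<close> assms(1) in \<open>auto simp: norm_inverse intro!: power_mono le_imp_inverse_le\<close>)
  then have "inverse r ^ n = 0"
    using inf 
    by (metis infsum_diverge_constant)
  with \<open>r > 0\<close> show False by simp
qed

text \<open>
  Away from the finitely many points of \<open>A\<close> close to the disc, every factor lies within
  \<open>1 / 2\<close> of \<open>1\<close>, so it is the exponential of its principal logarithm, and these logarithms are
  bounded on the whole disc by a summable family. An unordered product thereby becomes a finite
  product times the exponential of an unordered sum that converges uniformly, and the limit is
  holomorphic by Weierstrass. In this form the zeros of the limit can be read off: only the finite
  product can vanish.
\<close>

lemma canonical_product_local:
  fixes A :: "complex set"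
  assumes A0: "0 \<notin> A" and sumA: "(\<lambda>\<omega>. norm (inverse \<omega>) ^ Suc p) summable_on A" and R: "R > 0"
  obtains S G where "finite S" "S \<subseteq> A" "A \<inter> ball 0 R \<subseteq> S" "G holomorphic_on ball 0 R"
    "\<forall>z\<in>ball 0 R. ((\<lambda>W. \<Prod>\<omega>\<in>W. weierstrass_factor p (z / \<omega>)) \<longlongrightarrow>
        (\<Prod>\<omega>\<in>S. weierstrass_factor p (z / \<omega>)) * exp (G z)) (finite_subsets_at_top A)"
proof -
  \<comment> \<open>The radius forces \<open>norm (z / \<omega>) \<le> 1 / 8\<close> for \<open>\<omega>\<close> outside \<open>S\<close>; then
    \<open>3 * norm (z / \<omega>) ^ Suc p < 1 / 2\<close> holds for every genus, \<open>p = 0\<close> included.\<close>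
  define S where "S = A \<inter> ball 0 (8 * R)"
  have finS: "finite S"
    unfolding S_def using A0 sumA by (rule finite_summable_inverse_power)
  define B where "B = A - S"
  define h where "h = (\<lambda>\<omega> z. Ln (weierstrass_factor p (z / \<omega>)))"
  define G where "G = (\<lambda>z. \<Sum>\<^sub>\<infinity>\<omega>\<in>B. h \<omega> z)"
  have small: "norm (weierstrass_factor p (z / \<omega>) - 1) \<le> 3 * R ^ Suc p * norm (inverse \<omega>) ^ Suc p"
      "norm (weierstrass_factor p (z / \<omega>) - 1) < 1 / 2"
    if "\<omega> \<in> B" "z \<in> cball 0 R" for z \<omega>
  proof -
    have \<omega>: "norm \<omega> \<ge> 8 * R" using that by (auto simp: B_def S_def)
    have w: "norm (z / \<omega>) \<le> R * norm (inverse \<omega>)"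
      using that by (simp add: norm_mult norm_inverse divide_inverse mult_right_mono)
    have w': "R * norm (inverse \<omega>) \<le> 1 / 8"
      using \<omega> R by (cases "\<omega> = 0") (auto simp: norm_inverse norm_divide field_simps)
    have "norm (weierstrass_factor p (z / \<omega>) - 1) \<le> 3 * norm (z / \<omega>) ^ Suc p"
      by (rule weierstrass_factor_bound) (use w w' in linarith)
    also have "\<dots> \<le> 3 * (R * norm (inverse \<omega>)) ^ Suc p"
      by (intro mult_left_mono power_mono w) auto
    finally have 1: "norm (weierstrass_factor p (z / \<omega>) - 1) \<le> 3 * (R * norm (inverse \<omega>)) ^ Suc p" .
    then show "norm (weierstrass_factor p (z / \<omega>) - 1) \<le> 3 * R ^ Suc p * norm (inverse \<omega>) ^ Suc p"
      by (simp only: power_mult_distrib mult.assoc)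
    have "(R * norm (inverse \<omega>)) ^ Suc p \<le> (R * norm (inverse \<omega>)) ^ 1"
      by (rule power_decreasing) (use w' R in auto)
    with 1 w' show "norm (weierstrass_factor p (z / \<omega>) - 1) < 1 / 2" by simp
  qed
  have exp_h: "exp (h \<omega> z) = weierstrass_factor p (z / \<omega>)" if "\<omega> \<in> B" "z \<in> cball 0 R" for z \<omega>
    unfolding h_def by (rule exp_Ln) (use small(2)[OF that] in \<open>auto simp: norm_minus_commute\<close>)
  have h_bound: "norm (h \<omega> z) \<le> 6 * R ^ Suc p * norm (inverse \<omega>) ^ Suc p"
    if "\<omega> \<in> B" "z \<in> cball 0 R" for z \<omega>
    using norm_Ln_le[OF small(2)[OF that]] small(1)[OF that] by (simp add: h_def)
  have lim: "uniform_limit (cball 0 R) (\<lambda>W z. \<Sum>\<omega>\<in>W. h \<omega> z) G (finite_subsets_at_top B)"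
    unfolding G_def
    by (rule Weierstrass_m_test_general[OF h_bound])
       (auto simp: B_def simp del: power_Suc intro!: summable_on_cmult_right summable_on_subset_banach[OF sumA])
  have h_hol: "h \<omega> holomorphic_on cball 0 R" if "\<omega> \<in> B" for \<omega>
    unfolding h_def
  proof (rule holomorphic_on_Ln')
    show "(\<lambda>z. weierstrass_factor p (z / \<omega>)) holomorphic_on cball 0 R"
      using that A0 by (auto simp: B_def intro!: holomorphic_intros)
    fix z :: complex assume z: "z \<in> cball 0 R"
    let ?w = "weierstrass_factor p (z / \<omega>)"
    have "\<bar>Re (?w - 1)\<bar> < 1 / 2"
      using small(2)[OF that z] abs_Re_le_cmod[of "?w - 1"] by linarith
    then show "?w \<notin> \<real>\<^sub>\<le>\<^sub>0"
      by (auto simp: complex_nonpos_Reals_iff)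
  qed
  have G_hol: "G holomorphic_on ball 0 R"
  proof (rule holomorphic_uniform_limit[OF _ lim])
    have "(\<lambda>z. \<Sum>\<omega>\<in>W. h \<omega> z) holomorphic_on cball 0 R" if "W \<subseteq> B" for W
      using that h_hol by (auto intro!: holomorphic_intros)
    then show "\<forall>\<^sub>F W in finite_subsets_at_top B. continuous_on (cball 0 R) (\<lambda>z. \<Sum>\<omega>\<in>W. h \<omega> z) \<and>
        (\<lambda>z. \<Sum>\<omega>\<in>W. h \<omega> z) holomorphic_on ball 0 R"
      by (intro eventually_finite_subsets_at_top_weakI)
         (auto intro: holomorphic_on_imp_continuous_on holomorphic_on_subset[OF _ ball_subset_cball])
  qed auto
  have conv: "((\<lambda>W. \<Prod>\<omega>\<in>W. weierstrass_factor p (z / \<omega>)) \<longlongrightarrow>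
        (\<Prod>\<omega>\<in>S. weierstrass_factor p (z / \<omega>)) * exp (G z)) (finite_subsets_at_top A)"
    if z: "z \<in> ball 0 R" for z
  proof -
    have fl: "filterlim (\<lambda>W. W - S) (finite_subsets_at_top B) (finite_subsets_at_top A)"
      unfolding filterlim_finite_subsets_at_top B_def eventually_finite_subsets_at_top
      by (auto intro!: exI[where x = "_ :: complex set"])
    have "((\<lambda>W. \<Sum>\<omega>\<in>W. h \<omega> z) \<longlongrightarrow> G z) (finite_subsets_at_top B)"
      by (rule tendsto_uniform_limitI[OF lim]) (use z in auto)
    from filterlim_compose[OF this fl]
    have "((\<lambda>W. \<Sum>\<omega>\<in>W - S. h \<omega> z) \<longlongrightarrow> G z) (finite_subsets_at_top A)" .
    then have "((\<lambda>W. (\<Prod>\<omega>\<in>S. weierstrass_factor p (z / \<omega>)) * exp (\<Sum>\<omega>\<in>W - S. h \<omega> z)) \<longlongrightarrow>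
        (\<Prod>\<omega>\<in>S. weierstrass_factor p (z / \<omega>)) * exp (G z)) (finite_subsets_at_top A)"
      by (intro tendsto_intros)
    moreover have "\<forall>\<^sub>F W in finite_subsets_at_top A.
        (\<Prod>\<omega>\<in>S. weierstrass_factor p (z / \<omega>)) * exp (\<Sum>\<omega>\<in>W - S. h \<omega> z) =
        (\<Prod>\<omega>\<in>W. weierstrass_factor p (z / \<omega>))"
      unfolding eventually_finite_subsets_at_top
    proof (intro exI[of _ S] conjI allI impI)
      fix W assume W: "finite W \<and> S \<subseteq> W \<and> W \<subseteq> A"
      have "exp (\<Sum>\<omega>\<in>W - S. h \<omega> z) = (\<Prod>\<omega>\<in>W - S. weierstrass_factor p (z / \<omega>))"
        using W z by (subst exp_sum) (auto simp: B_def intro!: prod.cong exp_h)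
      then show "(\<Prod>\<omega>\<in>S. weierstrass_factor p (z / \<omega>)) * exp (\<Sum>\<omega>\<in>W - S. h \<omega> z) =
        (\<Prod>\<omega>\<in>W. weierstrass_factor p (z / \<omega>))"
        using W by (subst prod.subset_diff[of S W]) (auto simp: mult.commute)
    qed (use finS in \<open>auto simp: S_def\<close>)
    ultimately show ?thesis by (rule Lim_transform_eventually)
  qed
  show ?thesis
    by (rule that[OF finS _ _ G_hol]) (use R conv in \<open>auto simp: S_def\<close>)
qed

definition canonical_product :: "nat \<Rightarrow> complex set \<Rightarrow> complex \<Rightarrow> complex" where
  "canonical_product p A z =
     Lim (finite_subsets_at_top A) (\<lambda>W. \<Prod>\<omega>\<in>W. weierstrass_factor p (z / \<omega>))"

lemma
  fixes A :: "complex set"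
  assumes A0: "0 \<notin> A" and sumA: "(\<lambda>\<omega>. norm (inverse \<omega>) ^ Suc p) summable_on A"
  shows canonical_product_tendsto:
      "((\<lambda>W. \<Prod>\<omega>\<in>W. weierstrass_factor p (z / \<omega>)) \<longlongrightarrow> canonical_product p A z) (finite_subsets_at_top A)"
    and canonical_product_eq_0_iff: "canonical_product p A z = 0 \<longleftrightarrow> z \<in> A"
    and canonical_product_analytic: "canonical_product p A analytic_on {z}"
proof -
  have pos: "norm z + 1 > 0"
    by (simp add: add_nonneg_pos)
  obtain S G where SG: "finite S" "S \<subseteq> A" "A \<inter> ball 0 (norm z + 1) \<subseteq> S" "G holomorphic_on ball 0 (norm z + 1)"
    "\<forall>w\<in>ball 0 (norm z + 1). ((\<lambda>W. \<Prod>\<omega>\<in>W. weierstrass_factor p (w / \<omega>)) \<longlongrightarrow>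
        (\<Prod>\<omega>\<in>S. weierstrass_factor p (w / \<omega>)) * exp (G w)) (finite_subsets_at_top A)"
    using canonical_product_local[OF A0 sumA pos] by blast
  have eq: "canonical_product p A w = (\<Prod>\<omega>\<in>S. weierstrass_factor p (w / \<omega>)) * exp (G w)"
    if "w \<in> ball 0 (norm z + 1)" for w
    unfolding canonical_product_def by (rule tendsto_Lim[OF _ SG(5)[rule_format, OF that]]) simp
  have z: "z \<in> ball 0 (norm z + 1)" by simp
  show "((\<lambda>W. \<Prod>\<omega>\<in>W. weierstrass_factor p (z / \<omega>)) \<longlongrightarrow> canonical_product p A z) (finite_subsets_at_top A)"
    using SG(5)[rule_format, OF z] eq[OF z] by simp
  have "z \<in> S" if "z / \<omega> = 1" "\<omega> \<in> S" for \<omega>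
    using that by auto
  moreover have "z \<noteq> 0" if "z \<in> S" using that SG(2) A0 by auto
  ultimately show "canonical_product p A z = 0 \<longleftrightarrow> z \<in> A"
    using SG(1-3) z by (force simp: eq[OF z])
  have "(\<lambda>w. (\<Prod>\<omega>\<in>S. weierstrass_factor p (w / \<omega>)) * exp (G w)) holomorphic_on ball 0 (norm z + 1)"
    using SG(2,4) A0 by (auto intro!: holomorphic_intros)
  then have "canonical_product p A holomorphic_on ball 0 (norm z + 1)"
    by (rule holomorphic_transform) (simp add: eq)
  then show "canonical_product p A analytic_on {z}"
    by (rule holomorphic_on_imp_analytic_at) auto
qed

section \<open>Quasi-periodicity of the sigma function\<close>

text \<open>
  The additive subgroups of the plane over which the product of genus-2 factors converges. Summability
  of the inverse cubes also makes the subgroup discrete and countable.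
\<close>

locale sigma_lattice =
  fixes \<Lambda> :: "complex set"
  assumes zero_in: "0 \<in> \<Lambda>"
    and diff_in: "\<And>x y. x \<in> \<Lambda> \<Longrightarrow> y \<in> \<Lambda> \<Longrightarrow> x - y \<in> \<Lambda>"
    and summable_cubes: "(\<lambda>\<omega>. norm (inverse \<omega>) ^ 3) summable_on (\<Lambda> - {0})"
begin

definition sigma :: "complex \<Rightarrow> complex" where
  "sigma z = z * canonical_product 2 (\<Lambda> - {0}) z"

definition zeta :: "complex \<Rightarrow> complex" where
  "zeta z = deriv sigma z / sigma z"

definition partial_sigma :: "complex set \<Rightarrow> complex \<Rightarrow> complex" where
  "partial_sigma W z = z * (\<Prod>\<omega>\<in>W - {0}. weierstrass_factor 2 (z / \<omega>))"

lemma minus_in: "x \<in> \<Lambda> \<Longrightarrow> - x \<in> \<Lambda>"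
  using diff_in[OF zero_in] by simp

lemma add_in: "x \<in> \<Lambda> \<Longrightarrow> y \<in> \<Lambda> \<Longrightarrow> x + y \<in> \<Lambda>"
  using diff_in[of x "- y"] minus_in[of y] by simp

lemma add_in_iff: "\<omega> \<in> \<Lambda> \<Longrightarrow> x + \<omega> \<in> \<Lambda> \<longleftrightarrow> x \<in> \<Lambda>"
  using add_in[of x \<omega>] diff_in[of "x + \<omega>" \<omega>] by auto

lemma summable_cubes': "(\<lambda>\<omega>. norm (inverse \<omega>) ^ Suc 2) summable_on (\<Lambda> - {0})"
  using summable_cubes by (simp add: numeral_3_eq_3 numeral_2_eq_2)

lemma sigma_eq_0_iff: "sigma z = 0 \<longleftrightarrow> z \<in> \<Lambda>"
  using canonical_product_eq_0_iff[OF _ summable_cubes', of z] zero_in by (auto simp: sigma_def)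

lemma sigma_holomorphic: "sigma holomorphic_on UNIV"
proof -
  have "canonical_product 2 (\<Lambda> - {0}) holomorphic_on UNIV"
    using canonical_product_analytic[OF _ summable_cubes']
    by (meson DiffD2 analytic_imp_holomorphic analytic_on_analytic_at insertI1)
  then show ?thesis
    unfolding sigma_def by (intro holomorphic_intros)
qed

lemma sigma_deriv [derivative_intros]:
  assumes "(g has_field_derivative g') (at z)"
  shows "((\<lambda>z. sigma (g z)) has_field_derivative deriv sigma (g z) * g') (at z)"
  by (rule DERIV_chain2[OF holomorphic_derivI[OF sigma_holomorphic] assms]) auto

lemma partial_sigma_tendsto: "((\<lambda>W. partial_sigma W z) \<longlongrightarrow> sigma z) (finite_subsets_at_top \<Lambda>)"
proof -
  have "filterlim (\<lambda>W. W - {0}) (finite_subsets_at_top (\<Lambda> - {0})) (finite_subsets_at_top \<Lambda>)"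
    unfolding filterlim_finite_subsets_at_top eventually_finite_subsets_at_top
    by (intro allI impI exI) blast
  with canonical_product_tendsto[OF _ summable_cubes']
  have "((\<lambda>W. \<Prod>\<omega>\<in>W - {0}. weierstrass_factor 2 (z / \<omega>)) \<longlongrightarrow> canonical_product 2 (\<Lambda> - {0}) z)
      (finite_subsets_at_top \<Lambda>)"
    by (rule filterlim_compose) simp
  then show ?thesis
    unfolding partial_sigma_def sigma_def by (intro tendsto_intros)
qed

text \<open>
  The partial products satisfy \<open>partial_sigma W (- z) = - partial_sigma (uminus ` W) z\<close>, and negation
  merely permutes the finite subsets of the lattice, so the unordered limit inherits the relation.
\<close>

lemma sigma_minus: "sigma (- z) = - sigma z"
proof -
  have fl: "filterlim (\<lambda>W. uminus ` W) (finite_subsets_at_top \<Lambda>) (finite_subsets_at_top \<Lambda>)"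
    unfolding filterlim_finite_subsets_at_top eventually_finite_subsets_at_top
  proof (intro allI impI)
    fix X assume X: "finite X \<and> X \<subseteq> \<Lambda>"
    show "\<exists>Y. finite Y \<and> Y \<subseteq> \<Lambda> \<and> (\<forall>W. finite W \<and> Y \<subseteq> W \<and> W \<subseteq> \<Lambda> \<longrightarrow>
        finite (uminus ` W) \<and> X \<subseteq> uminus ` W \<and> uminus ` W \<subseteq> \<Lambda>)"
    proof (intro exI[of _ "uminus ` X"] conjI allI impI)
      fix W assume W: "finite W \<and> uminus ` X \<subseteq> W \<and> W \<subseteq> \<Lambda>"
      then have "uminus ` uminus ` X \<subseteq> uminus ` W" by blast
      then show "X \<subseteq> uminus ` W" by (simp add: image_image)
    qed (use X minus_in in auto)
  qed
  have "((\<lambda>W. - partial_sigma (uminus ` W) z) \<longlongrightarrow> - sigma z) (finite_subsets_at_top \<Lambda>)"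
    by (intro tendsto_minus filterlim_compose[OF partial_sigma_tendsto fl])
  also have "(\<lambda>W. - partial_sigma (uminus ` W) z) = (\<lambda>W. partial_sigma W (- z))"
  proof
    fix W
    have "(\<Prod>\<omega>\<in>uminus ` W - {0}. weierstrass_factor 2 (z / \<omega>)) = (\<Prod>\<omega>\<in>W - {0}. weierstrass_factor 2 (- z / \<omega>))"
      by (rule prod.reindex_bij_witness[of _ uminus uminus]) auto
    then show "- partial_sigma (uminus ` W) z = partial_sigma W (- z)"
      by (simp add: partial_sigma_def)
  qed
  finally show ?thesis
    using partial_sigma_tendsto[of "- z"] by (intro tendsto_unique[of "finite_subsets_at_top \<Lambda>"]) auto
qed

text \<open>
  A partial product is \<open>C * exp (A * z + B * z\<^sup>2)\<close> times the monic polynomial with root set \<open>V\<close>. If \<open>V\<close> is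
  invariant under \<open>z \<mapsto> \<omega>\<^sub>0 - z\<close>, then this reflection reproduces the polynomial up to sign, and since it
  has slope \<open>- 1\<close> it also leaves the quadratic coefficient \<open>B\<close> of the exponent unchanged. Only a linear
  exponential remains in the quotient. A nonzero translation never preserves a finite set, and for it
  the quadratic terms would cancel in the limit only; hence the detour through reflections.
\<close>

lemma partial_sigma_reflect:
  assumes "finite V" "0 \<in> V" and V: "\<And>x. x \<in> V \<Longrightarrow> \<omega>\<^sub>0 - x \<in> V"
  shows "\<exists>a c. \<forall>z. partial_sigma V (\<omega>\<^sub>0 - z) = c * exp (a * z) * partial_sigma V z"
proof -
  define C where "C = (\<Prod>\<omega>\<in>V - {0}. - 1 / \<omega>)"
  define A where "A = (\<Sum>\<omega>\<in>V - {0}. 1 / \<omega>)"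
  define B where "B = (\<Sum>\<omega>\<in>V - {0}. 1 / (2 * \<omega>\<^sup>2))"
  have partial_sigma_eq: "partial_sigma V z = C * exp (A * z + B * z\<^sup>2) * (\<Prod>\<omega>\<in>V. z - \<omega>)" for z
  proof -
    have wf: "weierstrass_factor 2 (z / \<omega>) = (- 1 / \<omega>) * exp (1 / \<omega> * z + 1 / (2 * \<omega>\<^sup>2) * z\<^sup>2) * (z - \<omega>)"
      if "\<omega> \<in> V - {0}" for \<omega>
    proof -
      have "(\<Sum>k = 1..2. (z / \<omega>) ^ k / of_nat k) = 1 / \<omega> * z + 1 / (2 * \<omega>\<^sup>2) * z\<^sup>2"
        by (simp add: numeral_2_eq_2 power_divide)
      moreover have "1 - z / \<omega> = (- 1 / \<omega>) * (z - \<omega>)"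
        using that by (simp add: field_simps)
      ultimately show ?thesis
        by (simp only: weierstrass_factor_def mult_ac)
    qed
    have "(\<Prod>\<omega>\<in>V - {0}. weierstrass_factor 2 (z / \<omega>)) =
        (\<Prod>\<omega>\<in>V - {0}. (- 1 / \<omega>) * exp (1 / \<omega> * z + 1 / (2 * \<omega>\<^sup>2) * z\<^sup>2) * (z - \<omega>))"
      by (intro prod.cong refl wf)
    also have "\<dots> = C * exp (A * z + B * z\<^sup>2) * (\<Prod>\<omega>\<in>V - {0}. z - \<omega>)"
      using assms(1) by (simp only: prod.distrib C_def A_def B_def sum_distrib_right
          exp_sum[symmetric] finite_Diff sum.distrib)
    finally show ?thesis
      using prod.remove[OF assms(1,2), of "\<lambda>\<omega>. z - \<omega>"]
      by (simp add: partial_sigma_def)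
  qed
  define c where "c = (-1) ^ card V * exp (A * \<omega>\<^sub>0 + B * \<omega>\<^sub>0\<^sup>2)"
  define a where "a = - 2 * A - 2 * B * \<omega>\<^sub>0"
  have "partial_sigma V (\<omega>\<^sub>0 - z) = c * exp (a * z) * partial_sigma V z" for z
  proof -
    have "(\<Prod>\<omega>\<in>V. \<omega>\<^sub>0 - z - \<omega>) = (\<Prod>\<omega>\<in>V. - 1 * (z - \<omega>))"
      by (rule prod.reindex_bij_witness[of _ "\<lambda>x. \<omega>\<^sub>0 - x" "\<lambda>x. \<omega>\<^sub>0 - x"]) (use V in auto)
    also have "\<dots> = (-1) ^ card V * (\<Prod>\<omega>\<in>V. z - \<omega>)"
      by (simp only: prod.distrib prod_constant)
    finally have 1: "(\<Prod>\<omega>\<in>V. \<omega>\<^sub>0 - z - \<omega>) = (-1) ^ card V * (\<Prod>\<omega>\<in>V. z - \<omega>)" .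
    have "A * (\<omega>\<^sub>0 - z) + B * (\<omega>\<^sub>0 - z)\<^sup>2 = (A * \<omega>\<^sub>0 + B * \<omega>\<^sub>0\<^sup>2) + a * z + (A * z + B * z\<^sup>2)"
      by (simp add: a_def power2_eq_square algebra_simps)
    then have "exp (A * (\<omega>\<^sub>0 - z) + B * (\<omega>\<^sub>0 - z)\<^sup>2) =
        exp (A * \<omega>\<^sub>0 + B * \<omega>\<^sub>0\<^sup>2) * exp (a * z) * exp (A * z + B * z\<^sup>2)"
      by (simp only: exp_add)
    then show ?thesis
      by (simp add: partial_sigma_eq 1 c_def)
  qed
  then show ?thesis by blast
qed

text \<open>
  The constants \<open>a\<close> and \<open>c\<close> of the partial products depend on the finite set. Combining four arguments with
  \<open>x + y = u + v\<close> eliminates them, so that the relation survives the passage to the limit without any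
  statement about the behaviour of \<open>a\<close> and \<open>c\<close>. The finite sets are symmetrised first; symmetric sets are
  cofinal among all finite subsets.
\<close>

lemma sigma_reflect:
  assumes \<omega>: "\<omega> \<in> \<Lambda>" and eq: "x + y = u + v"
  shows "sigma (\<omega> - x) * sigma (\<omega> - y) * (sigma u * sigma v) =
    sigma x * sigma y * (sigma (\<omega> - u) * sigma (\<omega> - v))"
proof -
  define S where "S = (\<lambda>W. insert 0 W \<union> (\<lambda>x. \<omega> - x) ` insert 0 W)"
  have "filterlim S (finite_subsets_at_top \<Lambda>) (finite_subsets_at_top \<Lambda>)"
    unfolding filterlim_finite_subsets_at_top
  proof (intro allI impI)
    fix X assume X: "finite X \<and> X \<subseteq> \<Lambda>"
    have "finite (S W) \<and> X \<subseteq> S W \<and> S W \<subseteq> \<Lambda>" if "finite W \<and> X \<subseteq> W \<and> W \<subseteq> \<Lambda>" for W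
      using that zero_in \<omega> diff_in by (auto simp: S_def)
    with X show "\<forall>\<^sub>F W in finite_subsets_at_top \<Lambda>. finite (S W) \<and> X \<subseteq> S W \<and> S W \<subseteq> \<Lambda>"
      unfolding eventually_finite_subsets_at_top by blast
  qed
  note lim = filterlim_compose[OF partial_sigma_tendsto this]
  let ?s = "\<lambda>W. partial_sigma (S W)"
  have 1: "((\<lambda>W. ?s W (\<omega> - x) * ?s W (\<omega> - y) * (?s W u * ?s W v)) \<longlongrightarrow>
      sigma (\<omega> - x) * sigma (\<omega> - y) * (sigma u * sigma v)) (finite_subsets_at_top \<Lambda>)"
    by (intro tendsto_mult lim)
  have 2: "((\<lambda>W. ?s W x * ?s W y * (?s W (\<omega> - u) * ?s W (\<omega> - v))) \<longlongrightarrow>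
      sigma x * sigma y * (sigma (\<omega> - u) * sigma (\<omega> - v))) (finite_subsets_at_top \<Lambda>)"
    by (intro tendsto_mult lim)
  have "?s W x * ?s W y * (?s W (\<omega> - u) * ?s W (\<omega> - v)) =
      ?s W (\<omega> - x) * ?s W (\<omega> - y) * (?s W u * ?s W v)" if "finite W" for W
  proof -
    have "finite (S W)" "0 \<in> S W" "\<And>x. x \<in> S W \<Longrightarrow> \<omega> - x \<in> S W"
      using that by (auto simp: S_def)
    then obtain a c where ac: "\<And>z. ?s W (\<omega> - z) = c * exp (a * z) * ?s W z"
      using partial_sigma_reflect[of "S W" \<omega>] by blast
    have "exp (a * x) * exp (a * y) = exp (a * u) * exp (a * v)"
      using eq by (simp add: exp_add[symmetric] distrib_left[symmetric])
    then show ?thesis by (simp add: ac)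
  qed
  then have "\<forall>\<^sub>F W in finite_subsets_at_top \<Lambda>. ?s W x * ?s W y * (?s W (\<omega> - u) * ?s W (\<omega> - v)) =
      ?s W (\<omega> - x) * ?s W (\<omega> - y) * (?s W u * ?s W v)"
    by (intro eventually_finite_subsets_at_top_weakI)
  from Lim_transform_eventually[OF 2 this] show ?thesis
    by (rule tendsto_unique[OF finite_subsets_at_top_neq_bot 1])
qed

text \<open>
  As \<open>sigma\<close> is odd, the reflection formula turns into one for translations: the function
  \<open>f z = sigma (z + \<omega>) / sigma z\<close> satisfies \<open>f x * f y = f u * f v\<close> whenever \<open>x + y = u + v\<close>, which
  characterises exponentials of affine functions among the nonvanishing entire functions.
\<close>

lemma sigma_shift:
  assumes "\<omega> \<in> \<Lambda>" and "x + y = u + v"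
  shows "sigma (x + \<omega>) * sigma (y + \<omega>) * (sigma u * sigma v) =
    sigma x * sigma y * (sigma (u + \<omega>) * sigma (v + \<omega>))"
proof -
  have "- x + - y = - u + - v"
    using arg_cong[OF assms(2), of uminus] by simp
  from sigma_reflect[OF assms(1) this] show ?thesis
    by (simp add: sigma_minus add.commute)
qed

text \<open>
  Logarithmic differentiation of the translation formula for the arguments \<open>(z + s) + w = (w + s) + z\<close>
  with respect to \<open>s\<close> at \<open>s = 0\<close>.
\<close>

lemma zeta_shift_diff:
  assumes \<omega>: "\<omega> \<in> \<Lambda>" and zw: "z \<notin> \<Lambda>" "w \<notin> \<Lambda>"
  shows "zeta (z + \<omega>) - zeta z = zeta (w + \<omega>) - zeta w"
proof -
  define D where "D = deriv sigma"
  have eq: "(\<lambda>s. sigma (z + s + \<omega>) * sigma (w + \<omega>) * (sigma (w + s) * sigma z)) =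
      (\<lambda>s. sigma (z + s) * sigma w * (sigma (w + s + \<omega>) * sigma (z + \<omega>)))"
    by (rule ext, rule sigma_shift[OF \<omega>]) simp
  have 1: "((\<lambda>s. sigma (z + s + \<omega>) * sigma (w + \<omega>) * (sigma (w + s) * sigma z)) has_field_derivative
      (D (z + \<omega>) * sigma w + sigma (z + \<omega>) * D w) * (sigma (w + \<omega>) * sigma z)) (at 0)"
    by (auto intro!: derivative_eq_intros simp: D_def algebra_simps)
  have 2: "((\<lambda>s. sigma (z + s) * sigma w * (sigma (w + s + \<omega>) * sigma (z + \<omega>))) has_field_derivative
      (D z * sigma (w + \<omega>) + sigma z * D (w + \<omega>)) * (sigma w * sigma (z + \<omega>))) (at 0)"
    by (auto intro!: derivative_eq_intros simp: D_def algebra_simps)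
  have "(D (z + \<omega>) * sigma w + sigma (z + \<omega>) * D w) * (sigma (w + \<omega>) * sigma z) =
      (D z * sigma (w + \<omega>) + sigma z * D (w + \<omega>)) * (sigma w * sigma (z + \<omega>))"
    using DERIV_unique[OF 1] 2 by (simp add: eq)
  moreover have "sigma z \<noteq> 0" "sigma w \<noteq> 0" "sigma (z + \<omega>) \<noteq> 0" "sigma (w + \<omega>) \<noteq> 0"
    using zw \<omega> by (auto simp: sigma_eq_0_iff add_in_iff)
  ultimately show ?thesis
    by (simp add: zeta_def D_def field_simps)
qed

lemma countable_lattice: "countable \<Lambda>"
proof -
  have "countable {\<omega> \<in> \<Lambda> - {0}. norm (inverse \<omega>) ^ 3 \<noteq> 0}"
    by (rule abs_summable_countable) (use summable_cubes in simp)
  also have "{\<omega> \<in> \<Lambda> - {0}. norm (inverse \<omega>) ^ 3 \<noteq> 0} = \<Lambda> - {0}" by auto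
  finally show ?thesis by simp
qed

lemma closed_lattice: "closed \<Lambda>"
proof -
  have "closed (sigma -` {0})"
    by (rule continuous_closed_vimage)
       (use sigma_holomorphic in \<open>auto simp: field_differentiable_imp_continuous_at holomorphic_on_def\<close>)
  also have "sigma -` {0} = \<Lambda>" by (auto simp: sigma_eq_0_iff)
  finally show ?thesis .
qed

text \<open>
  The quotient of the two sides has logarithmic derivative zero off the lattice, and the complement of
  a closed countable set in the plane is connected. The constant \<open>c\<close> has a classical closed form, but
  it cancels in every quotient of two sigma functions.
\<close>

lemma sigma_quasi_periodic:
  assumes \<omega>: "\<omega> \<in> \<Lambda>" and a: "a \<notin> \<Lambda>"
  obtains c where "c \<noteq> 0" "\<And>z. sigma (z + \<omega>) = c * exp ((zeta (a + \<omega>) - zeta a) * z) * sigma z"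
proof -
  define \<eta> where "\<eta> = zeta (a + \<omega>) - zeta a"
  define Q where "Q = (\<lambda>z. sigma (z + \<omega>) * exp (- \<eta> * z) / sigma z)"
  have "(Q has_field_derivative 0) (at z)" if "z \<notin> \<Lambda>" for z
  proof -
    have nz: "sigma z \<noteq> 0" "sigma (z + \<omega>) \<noteq> 0"
      using that \<omega> by (auto simp: sigma_eq_0_iff add_in_iff)
    have "\<eta> = deriv sigma (z + \<omega>) / sigma (z + \<omega>) - deriv sigma z / sigma z"
      using zeta_shift_diff[OF \<omega> a that] by (simp add: \<eta>_def zeta_def)
    then have "\<eta> * (sigma z * sigma (z + \<omega>)) = deriv sigma (z + \<omega>) * sigma z - deriv sigma z * sigma (z + \<omega>)"
      using nz by (simp add: field_simps)
    then have "(deriv sigma (z + \<omega>) * exp (- \<eta> * z) - \<eta> * exp (- \<eta> * z) * sigma (z + \<omega>)) * sigma z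
        - sigma (z + \<omega>) * exp (- \<eta> * z) * deriv sigma z = 0"
      by algebra
    then show ?thesis
      unfolding Q_def using nz
      by (auto intro!: derivative_eq_intros simp: algebra_simps)
  qed
  moreover have "open (- \<Lambda>)" "connected (- \<Lambda>)"
    using closed_lattice connected_open_diff_countable[of "UNIV :: complex set" \<Lambda>] countable_lattice
    by (auto simp: Compl_eq_Diff_UNIV)
  ultimately have "Q constant_on (- \<Lambda>)"
    by (intro DERIV_zero_connected_constant_on[of _ "{}"]) 
       (auto intro!: DERIV_continuous_on intro: has_field_derivative_at_within)
  then obtain c where c: "\<And>z. z \<notin> \<Lambda> \<Longrightarrow> Q z = c"
    by (auto simp: constant_on_def)
  have "sigma (z + \<omega>) = c * exp (\<eta> * z) * sigma z" for z
  proof (cases "z \<in> \<Lambda>")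
    case True
    then have "sigma z = 0" "sigma (z + \<omega>) = 0"
      using \<omega> by (simp_all add: sigma_eq_0_iff add_in_iff)
    then show ?thesis by simp
  next
    case False
    with c[OF this] show ?thesis
      by (auto simp: Q_def sigma_eq_0_iff field_simps exp_minus)
  qed
  moreover have "c \<noteq> 0"
    using c[OF a] a \<omega> by (auto simp: Q_def sigma_eq_0_iff add_in_iff)
  ultimately show ?thesis
    using that unfolding \<eta>_def by blast
qed

definition psi :: "complex \<Rightarrow> complex \<Rightarrow> complex" where
  "psi a x = - (sigma (x - a) / (sigma a * sigma x)) * exp (zeta a * x)"

text \<open>
  In the quotient \<open>sigma (x - a) / sigma x\<close> the factors \<open>c\<close> and \<open>exp (\<eta> * x)\<close> cancel, and the displacement
  by \<open>a\<close> leaves \<open>exp (- a * \<eta>)\<close>. Hence the multiplier does not depend on \<open>x\<close>. At lattice points both sides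
  are zero.
\<close>

lemma psi_quasi_periodic:
  assumes \<omega>: "\<omega> \<in> \<Lambda>" and a: "a \<notin> \<Lambda>"
  shows "psi a (x + \<omega>) = psi a x * exp (zeta a * \<omega> - a * (zeta (a + \<omega>) - zeta a))"
proof -
  obtain c where c: "c \<noteq> 0" "\<And>z. sigma (z + \<omega>) = c * exp ((zeta (a + \<omega>) - zeta a) * z) * sigma z"
    using sigma_quasi_periodic[OF assms] by metis
  define \<eta> where "\<eta> = zeta (a + \<omega>) - zeta a"
  have "sigma (x + \<omega> - a) = c * exp (\<eta> * (x - a)) * sigma (x - a)"
    using c(2)[of "x - a"] by (simp add: \<eta>_def algebra_simps)
  also have "exp (\<eta> * (x - a)) = exp (\<eta> * x) * exp (- a * \<eta>)"
    by (simp add: exp_add[symmetric] algebra_simps)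
  finally have 1: "sigma (x + \<omega> - a) = c * (exp (\<eta> * x) * exp (- a * \<eta>)) * sigma (x - a)" .
  have 2: "sigma (x + \<omega>) = c * exp (\<eta> * x) * sigma x"
    using c(2)[of x] by (simp add: \<eta>_def)
  have "exp (zeta a * (x + \<omega>)) = exp (zeta a * x) * exp (zeta a * \<omega>)"
    "exp (zeta a * \<omega> - a * \<eta>) = exp (zeta a * \<omega>) * exp (- a * \<eta>)"
    by (simp_all add: exp_add[symmetric] algebra_simps)
  then show ?thesis
    unfolding psi_def \<eta>_def[symmetric] 1 2 using c(1) by (simp add: field_simps)
qed

lemma psi_analytic:
  assumes "a \<notin> \<Lambda>" "z \<notin> \<Lambda>"
  shows "psi a analytic_on {z}"
proof -
  have *: "sigma analytic_on A" for A
    using sigma_holomorphic analytic_on_holomorphic by blast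
  have "(\<lambda>x. sigma (x - a)) analytic_on {z}"
    by (rule analytic_on_compose_gen[OF _ *[of UNIV], unfolded o_def]) (auto intro!: analytic_intros)
  then show ?thesis
    unfolding psi_def using assms
    by (intro analytic_intros) (auto simp: sigma_eq_0_iff *)
qed

lemma eventually_notin_lattice: "\<forall>\<^sub>F w in at z. w \<notin> \<Lambda>"
proof -
  have "finite ((\<Lambda> - {0}) \<inter> ball 0 (norm z + 1))"
    by (rule finite_summable_inverse_power[OF _ summable_cubes]) auto
  then have fin: "finite (\<Lambda> \<inter> ball 0 (norm z + 1))"
    by (rule rev_finite_subset[OF finite.insertI[of _ 0]]) auto
  have "open (ball 0 (norm z + 1) - (\<Lambda> \<inter> ball 0 (norm z + 1) - {z}))"
    by (intro open_Diff open_ball finite_imp_closed) (use fin in auto)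
  then have "\<forall>\<^sub>F w in at z. w \<in> ball 0 (norm z + 1) - (\<Lambda> \<inter> ball 0 (norm z + 1) - {z}) - {z}"
    by (rule eventually_at_in_open) auto
  then show ?thesis
    by (rule eventually_mono) auto
qed

text \<open>
  The lattice points are zeros of the denominator and not of the numerator, hence poles. Division by
  zero gives \<open>psi a\<close> the value \<open>0\<close> there, which is the normalised value at a pole.
\<close>

lemma psi_nicely_meromorphic:
  assumes a: "a \<notin> \<Lambda>"
  shows "psi a nicely_meromorphic_on UNIV"
proof (rule nicely_meromorphic_onI_open[where pts = \<Lambda>])
  show "psi a analytic_on UNIV - \<Lambda>"
    using psi_analytic[OF a] analytic_on_analytic_at by blast
  fix x
  show "isolated_singularity_at (psi a) x"
    using eventually_notin_lattice[of x] psi_analytic[OF a]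
    by (auto simp: isolated_singularity_at_altdef elim: eventually_mono)
next
  fix x assume x: "x \<in> \<Lambda>"
  have cont: "isCont sigma z" for z
    using sigma_holomorphic by (auto simp: field_differentiable_imp_continuous_at holomorphic_on_def)
  have "is_pole (\<lambda>x. (- sigma (x - a) * exp (zeta a * x)) / (sigma a * sigma x)) x"
  proof (rule is_pole_divide)
    show "isCont (\<lambda>x. - sigma (x - a) * exp (zeta a * x)) x"
      by (intro continuous_intros continuous_within_compose3[OF cont])
    have "(sigma \<longlongrightarrow> 0) (at x)"
      using cont[of x] x sigma_eq_0_iff[of x] by (simp add: isCont_def)
    then have "((\<lambda>x. sigma a * sigma x) \<longlongrightarrow> sigma a * 0) (at x)"
      by (intro tendsto_intros)
    moreover have "\<forall>\<^sub>F z in at x. sigma a * sigma z \<noteq> 0"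
      using eventually_notin_lattice[of x] by eventually_elim (use a in \<open>auto simp: sigma_eq_0_iff\<close>)
    ultimately show "filterlim (\<lambda>x. sigma a * sigma x) (at 0) (at x)"
      by (simp add: filterlim_at)
    \<comment> \<open>The zero of the denominator is not cancelled.\<close>
    have "x - a \<notin> \<Lambda>"
      using diff_in[OF x, of "x - a"] a by auto
    then show "- sigma (x - a) * exp (zeta a * x) \<noteq> 0"
      by (simp add: sigma_eq_0_iff)
  qed
  then show "is_pole (psi a) x \<and> psi a x = 0"
    using x sigma_eq_0_iff[of x] by (simp add: psi_def[abs_def])
qed auto

lemma psi_not_identically_0:
  assumes a: "a \<notin> \<Lambda>"
  shows "\<exists>x. psi a x \<noteq> 0"
proof -
  have "countable (\<Lambda> \<union> (\<lambda>x. x + a) ` \<Lambda>)"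
    using countable_lattice by auto
  then obtain x where x: "x \<notin> \<Lambda> \<union> (\<lambda>x. x + a) ` \<Lambda>"
    using uncountable_UNIV_complex by (metis countable_subset subsetI)
  then have "x - a \<notin> \<Lambda>"
    by (auto simp: image_iff dest: bspec[of _ _ "x - a"])
  with x a show ?thesis
    by (auto simp: psi_def sigma_eq_0_iff intro!: exI[of _ x])
qed

end

section \<open>The period lattice\<close>

text \<open>
  The majorant for both unordered sums that occur: with exponent \<open>3 / 2\<close> for the lattice sum, and with
  exponent \<open>2\<close> for Fourier coefficients.
\<close>

lemma summable_on_int_powr:
  assumes "s > 1"
  shows "(\<lambda>m::int. (1 + real_of_int \<bar>m\<bar>) powr - s) summable_on UNIV"
proof -
  let ?g = "\<lambda>m::int. (1 + real_of_int \<bar>m\<bar>) powr - s"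
  have "summable (\<lambda>n. real (Suc n) powr - s)"
    using assms by (subst summable_Suc_iff, subst summable_real_powr_iff) simp
  then have nat: "(\<lambda>n. (1 + real n) powr - s) summable_on UNIV"
    by (intro summable_nonneg_imp_summable_on) (simp_all add: add.commute)
  have "?g summable_on range int"
    using nat by (subst summable_on_reindex) (simp_all add: o_def)
  moreover have "?g summable_on range (\<lambda>n. - int n)"
    using nat by (subst summable_on_reindex) (simp_all add: o_def inj_def)
  moreover have "range int \<union> range (\<lambda>n. - int n) = UNIV"
    by (metis (no_types, lifting) UNIV_eq_I UnI1 UnI2 int_cases2 rangeI)
  ultimately show ?thesis
    using summable_on_union by fastforce
qed

text \<open>
  For \<open>(m, n) \<noteq> (0, 0)\<close> the modulus of a lattice point is at least \<open>c * M\<close> with \<open>M = max \<bar>m\<bar> \<bar>n\<bar>\<close>, and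
  \<open>(1 + \<bar>m\<bar>) * (1 + \<bar>n\<bar>) \<le> 4 * M\<^sup>2\<close>. The inverse cube is therefore bounded by a product of a function of
  \<open>m\<close> and a function of \<open>n\<close>, each of which decays with exponent \<open>3 / 2 > 1\<close>, and the double sum factors.
\<close>

lemma rectangular_lattice:
  fixes a b :: real
  assumes "a > 0" "b > 0"
  shows "sigma_lattice {of_real a * of_int m + of_real b * \<i> * of_int n | m n :: int. True}"
    (is "sigma_lattice ?L")
proof
  show "0 \<in> ?L"
    by (auto intro!: exI[of _ 0])
  fix x y assume "x \<in> ?L" "y \<in> ?L"
  then obtain m n m' n' :: int where
    "x = of_real a * of_int m + of_real b * \<i> * of_int n"
    "y = of_real a * of_int m' + of_real b * \<i> * of_int n'" by blast
  then have "x - y = of_real a * of_int (m - m') + of_real b * \<i> * of_int (n - n')"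
    by (simp add: algebra_simps)
  then show "x - y \<in> ?L" by blast
next
  define \<omega> where "\<omega> = (\<lambda>(m::int, n::int). of_real a * of_int m + of_real b * \<i> * of_int n :: complex)"
  define c where "c = min a b"
  define g where "g = (\<lambda>m::int. (1 + real_of_int \<bar>m\<bar>) powr - (3 / 2))"
  have Re: "Re (\<omega> (m, n)) = a * of_int m" and Im: "Im (\<omega> (m, n)) = b * of_int n" for m n
    by (simp_all add: \<omega>_def)
  have inj: "inj \<omega>"
  proof (rule injI)
    fix p q assume eq: "\<omega> p = \<omega> q"
    obtain m n m' n' where pq: "p = (m, n)" "q = (m', n')" by fastforce
    have "a * of_int m = a * of_int m'" "b * of_int n = b * of_int n'"
      using arg_cong[OF eq, of Re] arg_cong[OF eq, of Im] unfolding pq Re Im .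
    with assms show "p = q" by (simp add: pq)
  qed
  have eq: "?L - {0} = \<omega> ` (UNIV - {(0, 0)})"
  proof -
    have "?L = range \<omega>" unfolding \<omega>_def by auto
    moreover have "\<omega> (0, 0) = 0" by (simp add: \<omega>_def)
    ultimately show ?thesis using image_set_diff[OF inj, of UNIV "{(0, 0)}"] by simp
  qed
  have bound: "norm (inverse (\<omega> p)) ^ 3 \<le> 8 / c ^ 3 * (g (fst p) * g (snd p))" if "p \<noteq> (0, 0)" for p
  proof -
    obtain m n where p: "p = (m, n)" by fastforce
    define M where "M = max \<bar>real_of_int m\<bar> \<bar>real_of_int n\<bar>"
    have M: "M \<ge> 1"
      using that by (auto simp: p M_def le_max_iff_disj)
    have c: "c > 0" using assms by (simp add: c_def)
    have "c * \<bar>of_int m\<bar> \<le> norm (\<omega> p)" "c * \<bar>of_int n\<bar> \<le> norm (\<omega> p)"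
      using abs_Re_le_cmod[of "\<omega> p"] abs_Im_le_cmod[of "\<omega> p"] assms
        mult_right_mono[of c a "\<bar>of_int m\<bar>"] mult_right_mono[of c b "\<bar>of_int n\<bar>"]
      unfolding p Re Im by (auto simp: abs_mult c_def)
    then have "c * M \<le> norm (\<omega> p)"
      by (auto simp: M_def max_def)
    then have "norm (inverse (\<omega> p)) ^ 3 \<le> inverse (c * M) ^ 3"
      using M c unfolding norm_inverse by (intro power_mono le_imp_inverse_le) auto
    also have "\<dots> = 1 / c ^ 3 * (M\<^sup>2) powr - (3 / 2)"
    proof -
      have "(M\<^sup>2) powr - (3 / 2) = M powr (-3)"
        using M by (simp add: powr_powr flip: powr_numeral)
      also have "\<dots> = 1 / M ^ 3"
        using M by (simp add: powr_minus powr_numeral field_simps)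
      finally show ?thesis by (simp add: field_simps)
    qed
    also have "(M\<^sup>2) powr - (3 / 2) \<le> ((1 + \<bar>of_int m\<bar>) * (1 + \<bar>of_int n\<bar>) / 4) powr - (3 / 2)"
    proof (rule powr_mono2')
      have "(1 + \<bar>real_of_int m\<bar>) * (1 + \<bar>real_of_int n\<bar>) \<le> (2 * M) * (2 * M)"
        by (rule mult_mono) (use M in \<open>auto simp: M_def\<close>)
      then show "(1 + \<bar>of_int m\<bar>) * (1 + \<bar>of_int n\<bar>) / 4 \<le> M\<^sup>2"
        by (simp add: power2_eq_square)
    qed (auto intro!: divide_pos_pos mult_pos_pos add_pos_nonneg)
    also have "\<dots> = 8 * (g m * g n)"
    proof -
      have "(4::real) powr - (3 / 2) = (2 powr 2) powr - (3 / 2)" by simp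
      also have "\<dots> = 2 powr (-3)" by (subst powr_powr) simp
      also have "\<dots> = 1 / 8" by (simp add: powr_minus)
      finally have 4: "(4::real) powr - (3 / 2) = 1 / 8" .
      show ?thesis by (simp add: powr_divide powr_mult g_def 4)
    qed
    finally show ?thesis using c by (simp add: p mult_left_mono divide_right_mono)
  qed
  have g: "g summable_on UNIV"
    unfolding g_def by (rule summable_on_int_powr) simp
  have "(\<lambda>p. g (fst p) * g (snd p)) summable_on (SIGMA m:UNIV. UNIV)"
  proof (rule summable_on_SigmaI)
    fix m :: int
    show "((\<lambda>n. g (fst (m, n)) * g (snd (m, n))) has_sum g m * infsum g UNIV) UNIV"
      using g by (auto intro: has_sum_cmult_right)
  qed (use g in \<open>auto simp: g_def intro: summable_on_cmult_left\<close>)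
  then have "(\<lambda>p. g (fst p) * g (snd p)) summable_on (UNIV - {(0, 0)})"
    by (rule summable_on_subset_banach) simp
  then have "(\<lambda>p. 8 / c ^ 3 * (g (fst p) * g (snd p))) summable_on (UNIV - {(0, 0)})"
    by (rule summable_on_cmult_right)
  then have "(\<lambda>p. norm (inverse (\<omega> p)) ^ 3) summable_on (UNIV - {(0, 0)})"
    by (rule summable_on_comparison_test) (use bound in auto)
  then show "(\<lambda>\<omega>. norm (inverse \<omega>) ^ 3) summable_on (?L - {0})"
    unfolding eq by (subst summable_on_reindex) (use inj in \<open>auto simp: o_def inj_on_def\<close>)
qed

lemma ellK_pos:
  assumes "0 < k" "k < 1"
  shows "ellK k > 0"
proof -
  let ?f = "\<lambda>u. 1 / sqrt (1 - k^2 * (sin u)^2)"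
  have pos: "0 < 1 - k^2 * (sin u)^2" "1 - k^2 * (sin u)^2 \<le> 1" for u
  proof -
    have "k^2 * (sin u)^2 \<le> k^2 * 1"
      by (rule mult_left_mono) (auto simp: abs_square_le_1)
    also have "\<dots> < 1" using assms by (simp add: power_less_one_iff)
    finally show "0 < 1 - k^2 * (sin u)^2" by simp
  qed simp
  have "continuous_on {0..pi/2} ?f"
    by (intro continuous_intros) (use pos in \<open>auto simp: less_imp_neq[symmetric]\<close>)
  then have "?f integrable_on {0..pi/2}"
    by (rule integrable_continuous_real)
  moreover have "1 \<le> ?f u" for u
    using pos[of u] by (simp add: le_divide_eq)
  ultimately have "integral {0..pi/2} (\<lambda>_. 1) \<le> ellK k"
    unfolding ellK_def by (intro integral_le) auto
  then show ?thesis by (simp add: less_le_trans[OF pi_half_gt_zero])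
qed

lemma ellK'_pos:
  assumes "0 < k" "k < 1"
  shows "ellK' k > 0"
  unfolding ellK'_def
  by (rule ellK_pos) (use assms in \<open>auto simp: power_less_one_iff\<close>)

lemma sigma_lattice_lattice:
  assumes "0 < k" "k < 1"
  shows "sigma_lattice (lattice k)"
  unfolding lattice_def using rectangular_lattice[of "2 * ellK k" "2 * ellK' k"] ellK_pos[OF assms] ellK'_pos[OF assms]
  by simp

lemma
  assumes "0 < k" "k < 1"
  shows wsigma_eq: "wsigma k = sigma_lattice.sigma (lattice k)"
    and wzeta_eq: "wzeta k = sigma_lattice.zeta (lattice k)"
    and lame_Psi_eq: "lame_Psi k = sigma_lattice.psi (lattice k)"
proof -
  interpret sigma_lattice "lattice k"
    by (rule sigma_lattice_lattice[OF assms])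
  have "(\<lambda>z. (1 - z) * exp (z + 1 / 2 * z^2)) = weierstrass_factor 2"
    by (simp add: weierstrass_factor_def numeral_2_eq_2 fun_eq_iff)
  then have "(1 - z) * exp (z + 1 / 2 * z^2) = weierstrass_factor 2 z" for z
    by metis
  then show 1: "wsigma k = sigma"
    unfolding wsigma_def sigma_def canonical_product_def by presburger
  show 2: "wzeta k = zeta"
    unfolding wzeta_def zeta_def 1 ..
  show "lame_Psi k = psi"
    unfolding lame_Psi_def psi_def 1 2 ..
qed

section \<open>Fourier series of analytic periodic functions\<close>

text \<open>
  The Fourier coefficients of the restriction of \<open>f\<close> to the real line. The argument is a function of a
  complex variable because its regularity will be analyticity near the line.
\<close>

definition fourier_coeff :: "real \<Rightarrow> (complex \<Rightarrow> complex) \<Rightarrow> int \<Rightarrow> complex" where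
  "fourier_coeff T f m = 1 / of_real T *
     integral {0..T} (\<lambda>u. exp (- (2 * of_real pi * \<i> * of_int m / of_real T) * of_real u) * f (of_real u))"

lemma analytic_line_continuous:
  assumes "f analytic_on range complex_of_real"
  shows "continuous_on A (\<lambda>u. f (complex_of_real u))"
proof -
  have "isCont (\<lambda>u. f (complex_of_real u)) u" for u
  proof (rule isCont_o2[where g = f])
    have "f analytic_on {complex_of_real u}"
      using assms by (rule analytic_on_subset) auto
    then show "isCont f (complex_of_real u)"
      by (rule analytic_at_imp_isCont)
  qed (intro continuous_intros)
  then show ?thesis
    by (simp add: continuous_at_imp_continuous_on)
qed

lemma deriv_periodic:
  assumes "\<And>z. f (z + c) = f z"
  shows "deriv f (z + c) = deriv f (z::complex)"
proof -
  have "deriv (f \<circ> (\<lambda>x. z + c + x)) 0 = deriv (f \<circ> (\<lambda>x. z + x)) 0"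
    using assms[of "z + _"] by (simp add: o_def add_ac)
  then show ?thesis by (metis deriv_shift_0)
qed

context
  fixes T :: real and \<omega> :: "int \<Rightarrow> complex"
  assumes T: "T > 0"
  defines "\<omega> \<equiv> \<lambda>m. 2 * of_real pi * \<i> * of_int m / of_real T"
begin

lemma omega_diff: "\<omega> (m - n) = \<omega> m - \<omega> n"
  by (simp add: \<omega>_def diff_divide_distrib algebra_simps)

lemma exp_omega_period: "exp (\<omega> m * of_real T) = 1"
proof -
  have "\<omega> m * of_real T = of_int (2 * m) * of_real pi * \<i>"
    using T by (simp add: \<omega>_def)
  then show ?thesis
    by (auto simp: exp_eq_1)
qed

lemma fourier_coeff_eq: "fourier_coeff T f m = 1 / of_real T * integral {0..T} (\<lambda>u. exp (- \<omega> m * of_real u) * f (of_real u))"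
  by (simp add: fourier_coeff_def \<omega>_def)

lemma fourier_coeff_deriv:
  assumes f: "f analytic_on range complex_of_real" and per: "\<And>z. f (z + of_real T) = f z"
  shows "fourier_coeff T (deriv f) m = \<omega> m * fourier_coeff T f m"
proof -
  note cont = analytic_line_continuous[OF f] analytic_line_continuous[OF analytic_deriv[OF f]]
  let ?e = "\<lambda>u. exp (- \<omega> m * complex_of_real u)"
  have "((\<lambda>u. ?e u * deriv f (of_real u) - \<omega> m * (?e u * f (of_real u))) has_integral
      (?e T * f (of_real T) - ?e 0 * f (of_real 0))) {0..T}"
  proof (rule fundamental_theorem_of_calculus)
    fix u
    have "(f has_field_derivative deriv f (of_real u)) (at (of_real u))"
      using f by (meson analytic_derivI analytic_on_analytic_at rangeI)
    then have "((\<lambda>z. exp (- \<omega> m * z) * f z) has_field_derivative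
        (?e u * deriv f (of_real u) - \<omega> m * (?e u * f (of_real u)))) (at (of_real u))"
      by (auto intro!: derivative_eq_intros simp: algebra_simps)
    then show "((\<lambda>u. ?e u * f (of_real u)) has_vector_derivative
        (?e u * deriv f (of_real u) - \<omega> m * (?e u * f (of_real u)))) (at u within {0..T})"
      by (rule has_vector_derivative_real_field)
  qed (use T in auto)
  moreover have "?e T = 1"
    using exp_omega_period[of m] by (simp add: exp_minus)
  ultimately have "integral {0..T} (\<lambda>u. ?e u * deriv f (of_real u) - \<omega> m * (?e u * f (of_real u))) = 0"
    using per[of 0] by (simp add: integral_unique)
  moreover have "(\<lambda>u. ?e u * deriv f (of_real u)) integrable_on {0..T}"
      "(\<lambda>u. \<omega> m * (?e u * f (of_real u))) integrable_on {0..T}"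
    by (intro integrable_continuous_real continuous_intros cont)+
  ultimately have "integral {0..T} (\<lambda>u. ?e u * deriv f (of_real u)) = \<omega> m * integral {0..T} (\<lambda>u. ?e u * f (of_real u))"
    by (subst (asm) integral_diff) auto
  then show ?thesis by (simp add: fourier_coeff_eq)
qed

lemma fourier_coeff_bounded:
  assumes f: "f analytic_on range complex_of_real"
  shows "\<exists>B\<ge>0. \<forall>m. norm (fourier_coeff T f m) \<le> B"
proof -
  note cont = analytic_line_continuous[OF f]
  have "bounded ((\<lambda>u. f (complex_of_real u)) ` {0..T})"
    by (intro compact_imp_bounded compact_continuous_image cont) auto
  then obtain B where B: "B > 0" "\<And>u. u \<in> {0..T} \<Longrightarrow> norm (f (complex_of_real u)) \<le> B"
    by (auto simp: bounded_pos)
  have "norm (fourier_coeff T f m) \<le> B" for m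
  proof -
    have "norm (integral {0..T} (\<lambda>u. exp (- \<omega> m * of_real u) * f (of_real u))) \<le> B * (T - 0)"
    proof (rule integral_bound)
      fix u assume "u \<in> {0..T}"
      then show "norm (exp (- \<omega> m * of_real u) * f (of_real u)) \<le> B"
        using B(2) by (simp add: norm_mult \<omega>_def)
    qed (use T in \<open>auto intro!: continuous_intros cont\<close>)
    then show ?thesis
      using T by (simp add: fourier_coeff_eq norm_mult norm_divide field_simps)
  qed
  with B(1) show ?thesis by (intro exI[of _ B]) simp
qed

text \<open>
  Integrating by parts twice gives \<open>(\<omega> m)\<^sup>2 * fourier_coeff T f m = fourier_coeff T (deriv (deriv f)) m\<close>,
  and the coefficients of an analytic function are bounded.
\<close>

lemma fourier_coeff_abs_summable:
  assumes f: "f analytic_on range complex_of_real" and per: "\<And>z. f (z + of_real T) = f z"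
  shows "(\<lambda>m. norm (fourier_coeff T f m)) summable_on UNIV"
proof -
  have f': "deriv f analytic_on range complex_of_real" and f'': "deriv (deriv f) analytic_on range complex_of_real"
    using f by (simp_all add: analytic_deriv)
  obtain B where B: "B \<ge> 0" "\<And>m. norm (fourier_coeff T (deriv (deriv f)) m) \<le> B"
    using fourier_coeff_bounded[OF f''] by blast
  define w where "w = norm (\<omega> 1)"
  have w: "w > 0" using T by (simp add: w_def \<omega>_def norm_mult norm_divide)
  define C where "C = norm (fourier_coeff T f 0) + 4 * B / w\<^sup>2"
  have "norm (fourier_coeff T f m) \<le> C * (1 + real_of_int \<bar>m\<bar>) powr - 2" for m
  proof (cases "m = 0")
    case True
    then show ?thesis using B(1) by (simp add: C_def)
  next
    case False
    then have m: "real_of_int \<bar>m\<bar> \<ge> 1" by linarith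
    have "\<omega> m = of_int m * \<omega> 1"
      by (simp add: \<omega>_def)
    then have "norm (\<omega> m) = real_of_int \<bar>m\<bar> * w"
      by (simp add: norm_mult w_def)
    moreover have "fourier_coeff T (deriv (deriv f)) m = (\<omega> m)\<^sup>2 * fourier_coeff T f m"
      using fourier_coeff_deriv[OF f' deriv_periodic[of f "of_real T", OF per]]
        fourier_coeff_deriv[OF f per] by (simp add: power2_eq_square)
    ultimately have "(real_of_int \<bar>m\<bar> * w)\<^sup>2 * norm (fourier_coeff T f m) \<le> B"
      using B(2)[of m] by (simp add: norm_mult norm_power)
    moreover have "((1 + real_of_int \<bar>m\<bar>) / 2 * w)\<^sup>2 \<le> (real_of_int \<bar>m\<bar> * w)\<^sup>2"
      using m w by (intro power_mono mult_right_mono) auto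
    ultimately have "((1 + real_of_int \<bar>m\<bar>) / 2 * w)\<^sup>2 * norm (fourier_coeff T f m) \<le> B"
      by (meson mult_right_mono norm_ge_zero order_trans)
    then have "norm (fourier_coeff T f m) \<le> 4 * B / w\<^sup>2 / (1 + real_of_int \<bar>m\<bar>)\<^sup>2"
    proof -
      define M where "M = 1 + real_of_int \<bar>m\<bar>"
      have "M > 0" using m by (simp add: M_def)
      moreover assume "((1 + real_of_int \<bar>m\<bar>) / 2 * w)\<^sup>2 * norm (fourier_coeff T f m) \<le> B"
      then have "M\<^sup>2 * w\<^sup>2 / 4 * norm (fourier_coeff T f m) \<le> B"
        unfolding M_def[symmetric] by (simp add: power_mult_distrib power_divide)
      ultimately show ?thesis
        using w unfolding M_def[symmetric] by (simp add: field_simps)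
    qed
    also have "\<dots> \<le> C / (1 + real_of_int \<bar>m\<bar>)\<^sup>2"
      by (intro divide_right_mono) (auto simp: C_def)
    also have "\<dots> = C * (1 + real_of_int \<bar>m\<bar>) powr - 2"
      using m by (simp add: powr_minus powr_numeral divide_inverse)
    finally show ?thesis .
  qed
  then show ?thesis
    by (intro summable_on_comparison_test[OF summable_on_cmult_right[OF summable_on_int_powr[of 2], of C]]) auto
qed

text \<open>
  The derivative of a constant is zero, so integration by parts gives \<open>\<omega> m * fourier_coeff T (\<lambda>_. c) m = 0\<close>.
\<close>

lemma fourier_coeff_const: "fourier_coeff T (\<lambda>_. c) m = (if m = 0 then c else 0)"
proof (cases "m = 0")
  case True
  then show ?thesis using T by (simp add: fourier_coeff_def scaleR_conv_of_real)
next
  case False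
  have "fourier_coeff T (deriv (\<lambda>_. c)) m = \<omega> m * fourier_coeff T (\<lambda>_. c) m"
    by (rule fourier_coeff_deriv) auto
  moreover have "fourier_coeff T (deriv (\<lambda>_. c)) m = 0"
    by (simp add: fourier_coeff_def)
  moreover have "\<omega> m \<noteq> 0" using False T by (simp add: \<omega>_def)
  ultimately show ?thesis using False by simp
qed

text \<open>
  The zeros of \<open>z \<mapsto> exp (\<omega> 1 * (z - x)) - 1\<close> are simple and are the points \<open>x + n * T\<close>, where \<open>f z - f x\<close>
  vanishes too. So the quotient has only removable singularities on the line. It is filled in by the
  explicit value of the limit, a formula in \<open>z\<close> that is visibly periodic.
\<close>

lemma periodic_difference_quotient:
  assumes f: "f analytic_on range complex_of_real" and per: "\<And>z. f (z + of_real T) = f z"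
  shows "\<exists>q. q analytic_on range complex_of_real \<and> (\<forall>z. q (z + of_real T) = q z) \<and>
    (\<forall>z. f z - f (of_real x) = (exp (\<omega> 1 * (z - of_real x)) - 1) * q z)"
proof -
  define E where "E = (\<lambda>z. exp (\<omega> 1 * (z - of_real x)))"
  define q where "q = (\<lambda>z. if E z = 1 then deriv f z / \<omega> 1 else (f z - f (of_real x)) / (E z - 1))"
  have \<omega>1: "\<omega> 1 \<noteq> 0" using T by (simp add: \<omega>_def)
  have E_per: "E (z + of_real T) = E z" for z
  proof -
    have "E (z + of_real T) = E z * exp (\<omega> 1 * of_real T)"
      by (simp add: E_def exp_add[symmetric] algebra_simps)
    then show ?thesis by (simp add: exp_omega_period)
  qed
  have q_per: "q (z + of_real T) = q z" for z
    by (simp add: q_def E_per per deriv_periodic[of f "of_real T", OF per])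
  have per_nat: "f (z + of_nat n * of_real T) = f z" for z n
  proof (induction n)
    case (Suc n)
    then show ?case using per[of "z + of_nat n * of_real T"] by (simp add: algebra_simps)
  qed simp
  have f_eq: "f z = f (of_real x)" if "E z = 1" for z
  proof -
    have "\<exists>n::int. \<omega> 1 * (z - of_real x) = 2 * of_int n * of_real pi * \<i>"
      using that unfolding E_def exp_eq_1 by (auto simp: complex_eq_iff)
    then obtain n :: int where n: "\<omega> 1 * (z - of_real x) = 2 * of_int n * of_real pi * \<i>" ..
    also have "\<dots> = \<omega> 1 * (of_int n * of_real T)"
      using T by (simp add: \<omega>_def)
    finally have "z - of_real x = of_int n * of_real T"
      using \<omega>1 by simp
    then have z: "z = of_real x + of_int n * of_real T"
      by (simp add: algebra_simps)
    show ?thesis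
    proof (cases n rule: int_cases2)
      case (nonneg k)
      then show ?thesis using per_nat[of "of_real x" k] z by simp
    next
      case (nonpos k)
      then show ?thesis using per_nat[of z k] z by simp
    qed
  qed
  have q: "f z - f (of_real x) = (E z - 1) * q z" for z
    using f_eq[of z] by (simp add: q_def)
  have E_deriv: "(E has_field_derivative E z * \<omega> 1) (at z)" for z
    unfolding E_def by (auto intro!: derivative_eq_intros)
  have E_an: "E analytic_on A" for A
    unfolding E_def by (intro analytic_intros)
  have q_an: "q analytic_on {p}" if p: "f analytic_on {p}" for p
  proof (cases "E p = 1")
    case False
    have "\<forall>\<^sub>F z in nhds p. E z \<noteq> 1"
      by (rule tendsto_imp_eventually_ne[OF _ False])
         (use DERIV_isCont[OF E_deriv[of p]] in \<open>simp add: isCont_def tendsto_at_iff_tendsto_nhds\<close>)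
    then have ev: "\<forall>\<^sub>F z in nhds p. q z = (f z - f (of_real x)) / (E z - 1)"
      by eventually_elim (simp add: q_def)
    have "(\<lambda>z. (f z - f (of_real x)) / (E z - 1)) analytic_on {p}"
      using False by (intro analytic_intros p E_an) auto
    then show ?thesis using analytic_at_cong[OF ev refl] by simp
  next
    case True
    have dq: "((\<lambda>z. (E z - E p) / (z - p)) \<longlongrightarrow> \<omega> 1) (at p)"
      using E_deriv[of p] True by (simp add: has_field_derivative_iff)
    then have "\<forall>\<^sub>F z in at p. (E z - E p) / (z - p) \<noteq> 0"
      using \<omega>1 by (rule tendsto_imp_eventually_ne)
    then have ne: "\<forall>\<^sub>F z in at p. E z \<noteq> 1"
      by eventually_elim (use True in auto)
    have "(f has_field_derivative deriv f p) (at p)"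
      by (rule analytic_derivI[OF p])
    then have "((\<lambda>z. ((f z - f p) / (z - p)) / ((E z - E p) / (z - p))) \<longlongrightarrow> deriv f p / \<omega> 1) (at p)"
      by (intro tendsto_divide dq \<omega>1) (simp add: has_field_derivative_iff)
    moreover have "\<forall>\<^sub>F z in at p. ((f z - f p) / (z - p)) / ((E z - E p) / (z - p)) = q z"
      using ne eventually_neq_at_within[of p p]
      by eventually_elim (use True f_eq[OF True] in \<open>auto simp: q_def\<close>)
    ultimately have lim: "(q \<longlongrightarrow> q p) (at p)"
      using True by (simp add: q_def Lim_transform_eventually)
    obtain S where S: "open S" "p \<in> S" "f holomorphic_on S"
      using p by (auto simp: analytic_at)
    obtain S' where S': "open S'" "p \<in> S'" "\<And>z. z \<in> S' \<Longrightarrow> z \<noteq> p \<Longrightarrow> E z \<noteq> 1"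
      using ne by (auto simp: eventually_at_topological)
    have "q holomorphic_on (S \<inter> S')"
    proof (rule no_isolated_singularity'[where K = "{p}"])
      have "(\<lambda>z. (f z - f (of_real x)) / (E z - 1)) holomorphic_on (S \<inter> S' - {p})"
        using S'(3) by (intro holomorphic_intros holomorphic_on_subset[OF S(3)]
            analytic_imp_holomorphic[OF E_an]) auto
      then show "q holomorphic_on (S \<inter> S' - {p})"
        by (rule holomorphic_transform) (use S'(3) in \<open>auto simp: q_def\<close>)
      show "(q \<longlongrightarrow> q z) (at z within S \<inter> S')" if "z \<in> {p}" for z
        using lim that by (auto intro: tendsto_within_subset)
    qed (use S S' in auto)
    then show ?thesis
      using S S' by (auto simp: analytic_at)
  qed
  have "q analytic_on {p}" if "p \<in> range complex_of_real" for p
    by (rule q_an, rule analytic_on_subset[OF f]) (use that in simp)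
  then have "q analytic_on range complex_of_real"
    by (subst analytic_on_analytic_at) blast
  then show ?thesis
    using q_per q unfolding E_def by blast
qed

text \<open>
  Chernoff's argument for the convergence of a Fourier series at \<open>x\<close>. Write
  \<open>f z - f x = (exp (\<omega> 1 * (z - x)) - 1) * q z\<close> with \<open>q\<close> analytic and periodic. Multiplication by an
  exponential shifts the index of Fourier coefficients, so the term of index \<open>m\<close> of the series of
  \<open>f - f x\<close> at \<open>x\<close> is \<open>d (m - 1) - d m\<close>, where \<open>d\<close> is the series of \<open>q\<close> at \<open>x\<close>. Since \<open>d\<close> is absolutely
  summable, the sum of these differences is zero.
\<close>

theorem fourier_series_analytic:
  assumes f: "f analytic_on range complex_of_real" and per: "\<And>z. f (z + of_real T) = f z"
  shows "((\<lambda>m. fourier_coeff T f m * exp (\<omega> m * of_real x)) has_sum f (of_real x)) UNIV"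
proof -
  obtain q where q: "q analytic_on range complex_of_real" "\<And>z. q (z + of_real T) = q z"
    "\<And>z. f z - f (of_real x) = (exp (\<omega> 1 * (z - of_real x)) - 1) * q z"
    using periodic_difference_quotient[OF f per] by blast
  define d where "d = (\<lambda>m. fourier_coeff T q m * exp (\<omega> m * of_real x))"
  have "norm (d m) = norm (fourier_coeff T q m)" for m
    by (simp add: d_def norm_mult \<omega>_def)
  then have "(\<lambda>m. norm (d m)) summable_on UNIV"
    using fourier_coeff_abs_summable[OF q(1,2)] by simp
  then obtain S where S: "(d has_sum S) UNIV"
    using abs_summable_summable summable_on_def by blast
  then have S': "((\<lambda>m. d (m - 1)) has_sum S) UNIV"
    by (subst has_sum_reindex_bij_witness[of UNIV "\<lambda>m. m + 1" "\<lambda>m. m - 1" UNIV d _ S S]) auto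
  have 0: "((\<lambda>m. if m = 0 then f (of_real x) else 0) has_sum f (of_real x)) (UNIV :: int set)"
    by (rule has_sum_finite_neutralI[of "{0}"]) auto
  have "((\<lambda>m. (if m = 0 then f (of_real x) else 0) + (d (m - 1) + - d m)) has_sum
      (f (of_real x) + (S + - S))) UNIV"
    by (intro has_sum_add 0 S S' has_sum_uminusI)
  moreover have "fourier_coeff T f m * exp (\<omega> m * of_real x) =
      (if m = 0 then f (of_real x) else 0) + (d (m - 1) + - d m)" for m
  proof -
    let ?e = "\<lambda>m u. exp (- \<omega> m * complex_of_real u)"
    note cont = analytic_line_continuous[OF q(1)]
    have "?e m u * f (of_real u) = ?e m u * f (of_real x) +
        (exp (- \<omega> 1 * of_real x) * (?e (m - 1) u * q (of_real u)) - ?e m u * q (of_real u))" for u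
    proof -
      have "exp (- \<omega> 1 * of_real x) * ?e (m - 1) u = ?e m u * exp (\<omega> 1 * (of_real u - of_real x))"
        unfolding omega_diff exp_add[symmetric] by (simp add: algebra_simps)
      moreover have "f (of_real u) = f (of_real x) + (exp (\<omega> 1 * (of_real u - of_real x)) - 1) * q (of_real u)"
        using q(3)[of "of_real u"] by (simp add: algebra_simps)
      ultimately show ?thesis by algebra
    qed
    then have "integral {0..T} (\<lambda>u. ?e m u * f (of_real u)) =
        integral {0..T} (\<lambda>u. ?e m u * f (of_real x) +
        (exp (- \<omega> 1 * of_real x) * (?e (m - 1) u * q (of_real u)) - ?e m u * q (of_real u)))"
      by presburger
    also have "\<dots> = integral {0..T} (\<lambda>u. ?e m u * f (of_real x)) +
        (exp (- \<omega> 1 * of_real x) * integral {0..T} (\<lambda>u. ?e (m - 1) u * q (of_real u)) -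
         integral {0..T} (\<lambda>u. ?e m u * q (of_real u)))"
      by (subst integral_add integral_diff;
          (intro integrable_continuous_real continuous_intros cont)?)+ simp
    finally have "fourier_coeff T f m = fourier_coeff T (\<lambda>_. f (of_real x)) m +
        (exp (- \<omega> 1 * of_real x) * fourier_coeff T q (m - 1) - fourier_coeff T q m)"
      unfolding fourier_coeff_eq by (simp only: distrib_left right_diff_distrib mult.left_commute)
    moreover have "exp (- \<omega> 1 * of_real x) * exp (\<omega> m * of_real x) = exp (\<omega> (m - 1) * of_real x)"
      unfolding omega_diff exp_add[symmetric] by (simp add: algebra_simps)
    ultimately have "fourier_coeff T f m * exp (\<omega> m * of_real x) =
        fourier_coeff T (\<lambda>_. f (of_real x)) m * exp (\<omega> m * of_real x) + (d (m - 1) + - d m)"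
      unfolding d_def by algebra
    also have "fourier_coeff T (\<lambda>_. f (of_real x)) m * exp (\<omega> m * of_real x) =
        (if m = 0 then f (of_real x) else 0)"
      by (simp add: fourier_coeff_const \<omega>_def)
    finally show ?thesis .
  qed
  ultimately show ?thesis by simp
qed

end

section \<open>Laplace transforms of quasi-periodic functions\<close>

text \<open>
  The function \<open>exp (\<gamma> * u / T) * g u\<close> is continuous and \<open>T\<close>-periodic, hence bounded.
\<close>

lemma multiplier_exponential_bound:
  fixes g :: "real \<Rightarrow> complex"
  assumes T: "T > 0" and cont: "continuous_on UNIV g"
    and mult: "\<And>u. g (u + T) = exp (- \<gamma>) * g u"
  shows "\<exists>C. \<forall>u\<ge>0. norm (g u) \<le> C * exp (- (Re \<gamma> / T) * u)"
proof -
  define p where "p = (\<lambda>u. exp (of_real (u / T) * \<gamma>) * g u)"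
  have p_per: "p (u + T) = p u" for u
  proof -
    have "of_real ((u + T) / T) * \<gamma> = of_real (u / T) * \<gamma> + \<gamma>"
      using T by (simp add: add_divide_distrib distrib_right)
    then show ?thesis by (simp add: p_def mult exp_add exp_minus)
  qed
  have p_nat: "p (u + of_nat n * T) = p u" for u n
  proof (induction n)
    case (Suc n)
    then show ?case using p_per[of "u + of_nat n * T"] by (simp add: algebra_simps)
  qed simp
  have "continuous_on {0..T} p"
    unfolding p_def by (intro continuous_intros continuous_on_subset[OF cont]) (use T in auto)
  then have "bounded (p ` {0..T})"
    by (intro compact_imp_bounded compact_continuous_image) auto
  then obtain C where C: "\<And>u. u \<in> {0..T} \<Longrightarrow> norm (p u) \<le> C"
    unfolding bounded_iff by blast
  have "norm (g u) \<le> C * exp (- (Re \<gamma> / T) * u)" if "u \<ge> 0" for u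
  proof -
    define n where "n = nat \<lfloor>u / T\<rfloor>"
    have "real n = of_int \<lfloor>u / T\<rfloor>" using that T by (simp add: n_def)
    then have "real n \<le> u / T" "u / T < real n + 1" by linarith+
    then have "u - of_nat n * T \<in> {0..T}" using T by (auto simp: field_simps)
    from C[OF this] have "norm (p u) \<le> C"
      using p_nat[of "u - of_nat n * T" n] by simp
    moreover have "norm (p u) = exp (Re \<gamma> / T * u) * norm (g u)"
      by (simp add: p_def norm_mult mult.commute)
    ultimately show ?thesis by (simp add: exp_minus field_simps)
  qed
  then show ?thesis by blast
qed

text \<open>
  Splitting the half-line at \<open>T\<close> and translating the second part by \<open>T\<close> gives
  \<open>I = \<integral>\<^sub>0\<^sup>T g + exp (- \<gamma>) * I\<close> for the full integral \<open>I\<close>; this replaces the summation of a geometric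
  series over the periods.
\<close>

lemma integral_multiplier:
  fixes g :: "real \<Rightarrow> complex"
  assumes T: "T > 0" and cont: "continuous_on UNIV g"
    and mult: "\<And>u. g (u + T) = exp (- \<gamma>) * g u" and \<gamma>: "Re \<gamma> > 0"
  shows "g absolutely_integrable_on {0..}"
    and "(1 - exp (- \<gamma>)) * integral {0..} g = integral {0..T} g"
proof -
  obtain C where C: "\<And>u. u \<ge> 0 \<Longrightarrow> norm (g u) \<le> C * exp (- (Re \<gamma> / T) * u)"
    using multiplier_exponential_bound[OF T cont mult] by blast
  have meas: "g \<in> borel_measurable borel"
    using cont by (rule borel_measurable_continuous_onI)
  show abs: "g absolutely_integrable_on {0..}"
  proof (rule measurable_bounded_by_integrable_imp_absolutely_integrable[OF _ _ _ C])
    show "g \<in> borel_measurable (lebesgue_on {0..})"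
      using meas by (simp add: measurable_completion measurable_restrict_space1)
    have "(\<lambda>u. exp (- (Re \<gamma> / T) * u)) integrable_on {0..}"
      by (rule integrable_on_exp_minus_to_infinity) (use T \<gamma> in simp)
    from integrable_cmul[OF this, of C]
    show "(\<lambda>u. C * exp (- (Re \<gamma> / T) * u)) integrable_on {0..}" by simp
  qed auto
  have int: "set_integrable lborel {0..} g"
    using abs meas unfolding set_integrable_def
    by (subst (asm) integrable_completion) auto
  have int_T: "set_integrable lborel {0..<T} g" "set_integrable lborel {T..} g" "set_integrable lborel {0..T} g"
    by (rule set_integrable_subset[OF int]; use T in auto)+
  have "(LINT u:{0..}|lborel. g u) = (LINT u:{0..<T}|lborel. g u) + (LINT u:{T..}|lborel. g u)"
    using set_integral_Un[OF ivl_disj_int_one(8) int_T(1,2)] T by (simp add: ivl_disj_un)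
  also have "(LINT u:{T..}|lborel. g u) = (LINT u:{0..}|lborel. exp (- \<gamma>) * g u)"
  proof -
    have "(LINT u:{T..}|lborel. g u) = (LINT u|lborel. indicator {T..} (T + 1 * u) *\<^sub>R g (T + 1 * u))"
      unfolding set_lebesgue_integral_def by (subst lborel_integral_real_affine[of 1 _ T]) auto
    also have "\<dots> = (LINT u:{0..}|lborel. exp (- \<gamma>) * g u)"
      unfolding set_lebesgue_integral_def
      by (intro Bochner_Integration.integral_cong refl)
         (auto simp: indicator_def mult[symmetric] add.commute)
    finally show ?thesis .
  qed
  also have "\<dots> = exp (- \<gamma>) * (LINT u:{0..}|lborel. g u)"
    by simp
  also have "(LINT u:{0..<T}|lborel. g u) = integral {0..<T} g"
    by (rule set_borel_integral_eq_integral(2)[OF int_T(1)])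
  also have "\<dots> = integral {0..T} g"
    by (rule integral_spike_set) (auto intro: negligible_subset[of "{T}"])
  finally show "(1 - exp (- \<gamma>)) * integral {0..} g = integral {0..T} g"
    using set_borel_integral_eq_integral(2)[OF int] by (simp add: algebra_simps)
qed

lemma laplace_integral_holomorphic:
  fixes g :: "real \<Rightarrow> complex"
  assumes "continuous_on {a..b} g"
  shows "(\<lambda>s. integral {a..b} (\<lambda>u. exp (- s * of_real u) * g u)) holomorphic_on UNIV"
proof -
  have "(\<lambda>s. integral (cbox a b) (\<lambda>u. exp (- s * of_real u) * g u)) holomorphic_on UNIV"
  proof (rule leibniz_rule_holomorphic)
    fix s :: complex and u :: real
    show "((\<lambda>s. exp (- s * of_real u) * g u) has_field_derivative
        - of_real u * exp (- s * of_real u) * g u) (at s within UNIV)"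
      by (auto intro!: derivative_eq_intros)
    show "(\<lambda>u. exp (- s * of_real u) * g u) integrable_on cbox a b"
      using assms by (intro integrable_continuous continuous_intros) auto
    have "continuous_on (UNIV \<times> cbox a b) (\<lambda>p. g (snd p))"
      by (rule continuous_on_compose2[OF assms]) (auto intro!: continuous_intros)
    then show "continuous_on (UNIV \<times> cbox a b)
        (\<lambda>(s::complex, u). - of_real u * exp (- s * of_real u) * g u)"
      unfolding case_prod_unfold by (intro continuous_intros)
  qed auto
  then show ?thesis by simp
qed

text \<open>
  For \<open>Re s > 0\<close> the integrand of the Laplace transform is multiplied by \<open>exp (- (\<beta> + s * T))\<close> under
  translation by \<open>T\<close>, so the transform equals an entire function divided by \<open>1 - exp (- (\<beta> + s * T))\<close>.
  This quotient is the meromorphic continuation, and poles can occur only at the zeros of the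
  denominator, which form an arithmetic progression.
\<close>

lemma transfer_function_quasi_periodic:
  fixes \<phi> :: "complex \<Rightarrow> complex"
  assumes T: "T > 0" and cont: "continuous_on UNIV (\<lambda>u::real. \<phi> (of_real u))"
    and mult: "\<And>u::real. \<phi> (of_real (u + T)) = exp (- \<beta>) * \<phi> (of_real u)"
    and \<beta>: "Re \<beta> > 0"
  obtains F where "transfer_function \<phi> F"
    "{s. is_pole F s} \<subseteq> {- \<beta> / of_real T + of_int m * (2 * of_real pi * \<i> / of_real T) | m :: int. True}"
proof -
  define H where "H = (\<lambda>s. integral {0..T} (\<lambda>u. exp (- s * of_real u) * \<phi> (of_real u)))"
  define D where "D = (\<lambda>s. 1 - exp (- (\<beta> + s * of_real T)))"
  \<comment> \<open>The numerator may vanish at zeros of the denominator, so removable singularities can occur.\<close>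
  define F where "F = remove_sings (\<lambda>s. H s / D s)"
  have H_an: "H analytic_on A" for A
    using laplace_integral_holomorphic[OF continuous_on_subset[OF cont], of 0 T]
    unfolding H_def by (auto simp: analytic_on_holomorphic)
  have D_an: "D analytic_on A" for A
    unfolding D_def by (intro analytic_intros)
  have quot_an: "(\<lambda>s. H s / D s) analytic_on {s}" if "D s \<noteq> 0" for s
    using that by (intro analytic_intros H_an D_an) auto
  have "(\<lambda>s. H s / D s) meromorphic_on UNIV"
    by (intro meromorphic_intros analytic_on_imp_meromorphic_on H_an D_an)
  then have F_mero: "F nicely_meromorphic_on UNIV"
    unfolding F_def by (rule remove_sings_nicely_meromorphic)
  have "(\<lambda>u::real. exp (- s * of_real u) * \<phi> (of_real u)) absolutely_integrable_on {0..} \<and>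
      F s = integral {0..} (\<lambda>u::real. exp (- s * of_real u) * \<phi> (of_real u))" if s: "Re s > 0" for s
  proof -
    let ?g = "\<lambda>u::real. exp (- s * of_real u) * \<phi> (of_real u)"
    have g: "continuous_on UNIV ?g" by (intro continuous_intros cont)
    have g_mult: "?g (u + T) = exp (- (\<beta> + s * of_real T)) * ?g u" for u
      unfolding mult by (simp add: exp_add[symmetric] algebra_simps flip: mult.assoc)
    have \<gamma>: "Re (\<beta> + s * of_real T) > 0" using \<beta> s T by (simp add: add_pos_pos)
    note I = integral_multiplier[OF T g g_mult \<gamma>]
    have "norm (exp (- (\<beta> + s * of_real T))) < 1"
      using \<gamma> by simp
    then have D: "D s \<noteq> 0" unfolding D_def by (metis eq_iff_diff_eq_0 less_irrefl norm_one)
    have "F s = H s / D s"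
      unfolding F_def by (rule remove_sings_at_analytic[OF quot_an[OF D]])
    also have "H s = D s * integral {0..} ?g"
      using I(2) by (simp add: H_def D_def)
    finally show ?thesis using I(1) D by simp
  qed
  with F_mero have "transfer_function \<phi> F"
    unfolding transfer_function_def by blast
  moreover have "\<exists>m::int. s = - \<beta> / of_real T + of_int m * (2 * of_real pi * \<i> / of_real T)" if "is_pole F s" for s
  proof -
    have "D s = 0"
    proof (rule ccontr)
      assume "D s \<noteq> 0"
      then have "(\<lambda>s. H s / D s) analytic_on {s}" by (rule quot_an)
      then have "F analytic_on {s}" unfolding F_def by (intro remove_sings_analytic_on)
      then show False using that analytic_at_imp_no_pole by blast
    qed
    then have "exp (\<beta> + s * of_real T) = 1"
      using exp_minus[of "\<beta> + s * of_real T"] by (simp add: D_def del: minus_add_distrib)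
    then obtain m :: int where "Re (\<beta> + s * of_real T) = 0" "Im (\<beta> + s * of_real T) = of_int (2 * m) * pi"
      unfolding exp_eq_1 by blast
    then have "\<beta> + s * of_real T = of_int m * (2 * of_real pi * \<i>)"
      by (simp add: complex_eq_iff)
    then have "s = - \<beta> / of_real T + of_int m * (2 * of_real pi * \<i> / of_real T)"
      using T by (simp add: field_simps eq_neg_iff_add_eq_0) 
    then show ?thesis ..
  qed
  ultimately show ?thesis by (intro that[of F]) auto
qed

section \<open>Quasi-periodic solutions of the Lame equation\<close>

lemma nicely_meromorphic_shift:
  assumes "f nicely_meromorphic_on UNIV"
  shows "(\<lambda>z. f (z + c)) nicely_meromorphic_on UNIV"
  unfolding nicely_meromorphic_on_def
proof (intro conjI ballI)
  have "f meromorphic_on UNIV"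
    using assms by (simp add: nicely_meromorphic_on_def)
  moreover have "(\<lambda>z. z + c) analytic_on UNIV"
    by (intro analytic_intros)
  ultimately show "(\<lambda>z. f (z + c)) meromorphic_on UNIV"
    by (rule meromorphic_on_compose) simp
  fix z
  have "is_pole f (z + c) \<and> f (z + c) = 0 \<or> f \<midarrow>z + c\<rightarrow> f (z + c)"
    using assms by (auto simp: nicely_meromorphic_on_def)
  moreover have "is_pole f (z + c) \<longleftrightarrow> is_pole (\<lambda>z. f (z + c)) z"
    using is_pole_shift_iff[of f c z] by (simp add: o_def add.commute)
  moreover have "f \<midarrow>z + c\<rightarrow> f (z + c) \<Longrightarrow> (\<lambda>z. f (z + c)) \<midarrow>z\<rightarrow> f (z + c)"
    using LIM_offset[of f "f (z + c)" "z + c" c] by simp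
  ultimately show "is_pole (\<lambda>z. f (z + c)) z \<and> f (z + c) = 0 \<or> (\<lambda>z. f (z + c)) \<midarrow>z\<rightarrow> f (z + c)"
    by blast
qed

theorem lemma8p2:
  fixes k :: real and \<alpha> t :: complex
  assumes "0 < k" and "k < 1"
    and "\<alpha> \<notin> lattice k"
    and "Re (lame_beta k \<alpha>) > 0"
    and "(\<lambda>x. lame_Psi k \<alpha> (x + 2 * t)) analytic_on (complex_of_real ` {0..2 * ellK k})"
  shows "theta_function (lattice k) (lame_phi k \<alpha> t)
    \<and> (\<forall>x::real. x > 0 \<longrightarrow>
         ((\<lambda>m::int. 1 / (2 * of_real (ellK k))
              * lame_h k \<alpha> t ((2 * of_real pi * \<i> * of_int m - lame_beta k \<alpha>) / (2 * of_real (ellK k)))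
              * exp (of_real x * (2 * of_real pi * \<i> * of_int m - lame_beta k \<alpha>) / (2 * of_real (ellK k))))
            has_sum lame_phi k \<alpha> t (of_real x)) UNIV)
    \<and> (\<exists>F. transfer_function (lame_phi k \<alpha> t) F
         \<and> (\<exists>a d. d \<noteq> 0 \<and> {s. is_pole F s} \<subseteq> {a + of_int m * d | m :: int. True}))"
proof -
  define \<Lambda> where "\<Lambda> = lattice k"
  interpret sigma_lattice \<Lambda>
    unfolding \<Lambda>_def by (rule sigma_lattice_lattice[OF assms(1,2)])
  note \<alpha> = assms(3)[folded \<Lambda>_def]
  define T where "T = 2 * ellK k"
  have T: "T > 0" using ellK_pos[OF assms(1,2)] by (simp add: T_def)
  have period_in: "of_int n * of_real T \<in> \<Lambda>" for n
  proof -
    have "of_int n * of_real T = of_real (2 * ellK k) * of_int n + of_real (2 * ellK' k) * \<i> * of_int 0"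
      by (simp add: T_def mult.commute)
    then show ?thesis unfolding \<Lambda>_def lattice_def by blast
  qed
  define \<beta> where "\<beta> = lame_beta k \<alpha>"
  note \<beta> = assms(4)[folded \<beta>_def]
  define \<phi> where "\<phi> = lame_phi k \<alpha> t"
  have \<phi>: "\<phi> z = psi \<alpha> (z + 2 * t)" for z
    by (simp add: \<phi>_def lame_phi_def lame_Psi_eq[OF assms(1,2)] \<Lambda>_def)
  define M where "M = (\<lambda>u. zeta \<alpha> * u - \<alpha> * (zeta (\<alpha> + u) - zeta \<alpha>))"
  have \<phi>_shift: "\<phi> (z + u) = \<phi> z * exp (M u)" if "u \<in> \<Lambda>" for z u
    using psi_quasi_periodic[OF that \<alpha>, of "z + 2 * t"] by (simp add: \<phi> M_def add_ac)
  \<comment> \<open>The number \<open>\<beta>\<close> is exactly the exponent by which \<open>\<phi>\<close> decays over the real period.\<close>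
  have M_T: "M (of_real T) = - \<beta>"
    by (simp add: M_def \<beta>_def lame_beta_def T_def wzeta_eq[OF assms(1,2)] \<Lambda>_def algebra_simps)
  have \<phi>_period: "\<phi> (z + of_real T) = exp (- \<beta>) * \<phi> z" for z
    using \<phi>_shift[of "of_real T" z] period_in[of 1] by (simp add: M_T)

  have theta: "theta_function \<Lambda> \<phi>"
    unfolding theta_function_def
  \<comment> \<open>The multiplier \<open>exp (M u)\<close> is independent of the argument, so the linear part \<open>L\<close> can be zero.\<close>
  proof (intro conjI exI[of _ "\<lambda>_ _. 0"] exI[of _ "\<lambda>u. M u / (2 * of_real pi * \<i>)"])
    show "\<phi> nicely_meromorphic_on UNIV"
      using nicely_meromorphic_shift[OF psi_nicely_meromorphic[OF \<alpha>]] by (simp add: \<phi>[abs_def])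
    show "\<exists>x. \<phi> x \<noteq> 0"
      using psi_not_identically_0[OF \<alpha>] by (auto simp: \<phi> intro: exI[of _ "_ - 2 * t"])
    show "\<forall>u\<in>\<Lambda>. Vector_Spaces.linear (*) (*) (\<lambda>x :: complex. 0 :: complex)"
      by (intro ballI, unfold_locales) (simp_all add: algebra_simps)
    show "\<forall>x. \<forall>u\<in>\<Lambda>. \<phi> (x + u) = \<phi> x * exp (2 * of_real pi * \<i> * (0 + M u / (2 * of_real pi * \<i>)))"
      by (simp add: \<phi>_shift)
  qed

  have segment: "\<phi> analytic_on (complex_of_real ` {0..T})"
    using assms(5) by (simp add: \<phi>_def lame_phi_def[abs_def] T_def)
  have \<phi>_analytic: "\<phi> analytic_on range complex_of_real"
  proof (subst analytic_on_analytic_at, intro ballI)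
    fix z assume "z \<in> range complex_of_real"
    then obtain u where z: "z = of_real u" by blast
    \<comment> \<open>Analyticity on one period segment propagates by the functional equation.\<close>
    define n where "n = \<lfloor>u / T\<rfloor>"
    have "of_int n \<le> u / T" "u / T < of_int n + 1" by (simp_all add: n_def)
    then have "u - of_int n * T \<in> {0..T}" using T by (auto simp: field_simps)
    then have "{complex_of_real (u - of_int n * T)} \<subseteq> of_real ` {0..T}"
      by blast
    from analytic_on_subset[OF segment this] have "\<phi> analytic_on (\<lambda>w. w - of_int n * of_real T) ` {z}"
      by (simp add: z)
    moreover have "(\<lambda>w. w - of_int n * of_real T) analytic_on {z}"
      by (intro analytic_intros)
    ultimately have "(\<lambda>w. \<phi> (w - of_int n * of_real T)) analytic_on {z}"
      using analytic_on_compose[of "\<lambda>w. w - of_int n * of_real T" "{z}" \<phi>] by (simp add: o_def)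
    then have "(\<lambda>z. \<phi> (z - of_int n * of_real T) * exp (M (of_int n * of_real T))) analytic_on {z}"
      by (rule analytic_on_mult) (rule analytic_on_const)
    moreover have "\<phi> = (\<lambda>z. \<phi> (z - of_int n * of_real T) * exp (M (of_int n * of_real T)))"
      by (simp flip: \<phi>_shift[OF period_in])
    ultimately show "\<phi> analytic_on {z}" by metis
  qed

  have series: "((\<lambda>m::int. 1 / of_real T * lame_h k \<alpha> t ((2 * of_real pi * \<i> * of_int m - \<beta>) / of_real T)
        * exp (of_real x * (2 * of_real pi * \<i> * of_int m - \<beta>) / of_real T)) has_sum \<phi> (of_real x)) UNIV"
    for x :: real
  proof -
    \<comment> \<open>Compensating the decay makes the function periodic; its Fourier coefficients are values of \<open>h\<close> divided by \<open>T\<close>.\<close>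
    define f where "f = (\<lambda>z. exp (\<beta> / of_real T * z) * \<phi> z)"
    have f_an: "f analytic_on range complex_of_real"
      unfolding f_def by (intro analytic_intros \<phi>_analytic)
    have f_per: "f (z + of_real T) = f z" for z
    proof -
      have "\<beta> / of_real T * (z + of_real T) = \<beta> / of_real T * z + \<beta>"
        using T by (simp add: distrib_left)
      then have "f (z + of_real T) = exp (\<beta> / of_real T * z) * exp \<beta> * (exp (- \<beta>) * \<phi> z)"
        unfolding f_def \<phi>_period by (simp only: exp_add)
      then show ?thesis by (simp add: f_def exp_minus)
    qed
    let ?w = "\<lambda>m::int. 2 * of_real pi * \<i> * of_int m / complex_of_real T"
    have "((\<lambda>m. exp (- (\<beta> / of_real T * of_real x)) * (fourier_coeff T f m * exp (?w m * of_real x)))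
        has_sum exp (- (\<beta> / of_real T * of_real x)) * f (of_real x)) UNIV"
      by (intro has_sum_cmult_right fourier_series_analytic[OF T f_an f_per])
    also have "exp (- (\<beta> / of_real T * of_real x)) * f (of_real x) = \<phi> (of_real x)"
      by (simp add: f_def exp_minus)
    also have "(\<lambda>m. exp (- (\<beta> / of_real T * of_real x)) * (fourier_coeff T f m * exp (?w m * of_real x))) =
        (\<lambda>m. 1 / of_real T * lame_h k \<alpha> t ((2 * of_real pi * \<i> * of_int m - \<beta>) / of_real T)
        * exp (of_real x * (2 * of_real pi * \<i> * of_int m - \<beta>) / of_real T))"
    proof
      fix m :: int
      have "exp (- ?w m * of_real u) * f (of_real u) =
          exp (- ((2 * of_real pi * \<i> * of_int m - \<beta>) / of_real T) * of_real u) * \<phi> (of_real u)" for u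
        unfolding f_def mult.assoc[symmetric] exp_add[symmetric]
        by (simp add: diff_divide_distrib algebra_simps)
      then have 1: "fourier_coeff T f m = 1 / of_real T * lame_h k \<alpha> t ((2 * of_real pi * \<i> * of_int m - \<beta>) / of_real T)"
        unfolding fourier_coeff_def lame_h_def \<phi>_def T_def by simp
      have 2: "exp (- (\<beta> / of_real T * of_real x)) * exp (?w m * of_real x) =
          exp (of_real x * (2 * of_real pi * \<i> * of_int m - \<beta>) / of_real T)"
        by (simp add: exp_add[symmetric] diff_divide_distrib algebra_simps)
      show "exp (- (\<beta> / of_real T * of_real x)) * (fourier_coeff T f m * exp (?w m * of_real x)) =
        1 / of_real T * lame_h k \<alpha> t ((2 * of_real pi * \<i> * of_int m - \<beta>) / of_real T)
        * exp (of_real x * (2 * of_real pi * \<i> * of_int m - \<beta>) / of_real T)"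
        unfolding 1 2[symmetric] by (simp only: mult_ac)
    qed
    finally show ?thesis .
  qed

  obtain F where F: "transfer_function \<phi> F"
    "{s. is_pole F s} \<subseteq> {- \<beta> / of_real T + of_int m * (2 * of_real pi * \<i> / of_real T) | m :: int. True}"
  proof (rule transfer_function_quasi_periodic[OF T _ _ \<beta>])
    show "continuous_on UNIV (\<lambda>u. \<phi> (complex_of_real u))"
      by (rule analytic_line_continuous[OF \<phi>_analytic])
    show "\<phi> (of_real (u + T)) = exp (- \<beta>) * \<phi> (of_real u)" for u
      using \<phi>_period[of "of_real u"] by simp
  qed
  have "2 * of_real pi * \<i> / of_real T \<noteq> (0 :: complex)"
    using T by simp
  with F have transfer: "\<exists>F. transfer_function \<phi> F \<and>
      (\<exists>a d. d \<noteq> 0 \<and> {s. is_pole F s} \<subseteq> {a + of_int m * d | m :: int. True})"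
    by blast
  have T_of_real: "complex_of_real T = 2 * of_real (ellK k)"
    by (simp add: T_def)
  show ?thesis
    using theta transfer series unfolding \<phi>_def \<Lambda>_def \<beta>_def T_of_real
    by (intro conjI allI impI)
qed

end
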